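(* Let $S$ be an invariant surface in Sol with constant intrinsic Gaussian curvature $K_{int}=c$, with maximal generating curve $\alpha$. Up to integration constants, we have the following classification: (1) If $c=0$, then $S$ is a leaf of $\mathcal{F}_3$, or the generating curve of $S$ is $$\alpha(s)=\Big(0,\ \tfrac12\big(s\sqrt{s^2-1}-\log(s+\sqrt{s^2-1})\big),\ \log(s)\Big),\qquad s>1.$$ (2) If $c=-1$, then $S$ is a leaf of $\mathcal{F}_2$, or the generating curve is the graph of $z(y)=\log(\cosh(y))$. (3) If $c\in(-1,0)$, then $\alpha$ is a graph of type $z(y)=\log(y)$ (that is, $z(y)=\log(ay)$ for some constant $a\neq 0$), or $\alpha$ is the graph of a function $z(y)$ defined on the whole real line $\mathbb{R}$ with a single minimum, or $\alpha$ is the graph of a monotonic function $z(y)$ defined on some interval $(a_0,\infty)$. (4) If $c>0$ or $c<-1$, then $\alpha$ is the graph of a bounded function $z(y)$ defined on a bounded interval $(a_0,b_0)$, with a single maximum or minimum, and it is vertical at the end points of $(a_0,b_0)$ (i.e. the tangent direction of $\alpha$ tends to the $z$-direction there). Moreover, except when $S$ is a leaf of $\mathcal{F}_2$, the generating curve is a graph of a function $z=z(y)$.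
   Context: Sol is $\mathbb{R}^3$ with the Riemannian metric $e^{2z}dx^2+e^{-2z}dy^2+dz^2$. An orthonormal frame is $E_1=e^{-z}\partial_x$, $E_2=e^{z}\partial_y$, $E_3=\partial_z$. An invariant surface is a surface invariant under the one-parameter group of isometries $T_{1,c}(x,y,z)=(x+c,y,z)$, $c\in\mathbb{R}$. It is parametrized by $X(s,t)=(t,y(s),z(s))$, $s\in I$ (an open interval), $t\in\mathbb{R}$, where $\alpha(s)=(0,y(s),z(s))$ is the generating curve, parametrized by arc length: $y'=e^{z}\cos\theta$, $z'=\sin\theta$ for a smooth angle function $\theta=\theta(s)$. $K_{int}$ is the Gaussian curvature of the induced metric on $S$; for an invariant surface $K_{int}=-\theta'\cos\theta-\sin^2\theta$. The foliations are $\mathcal{F}_2=\{Q_t\}_{t\in\mathbb{R}}$, $Q_t=\{(x,t,z):x,z\in\mathbb{R}\}$, and $\mathcal{F}_3=\{R_t\}_{t\in\mathbb{R}}$, $R_t=\{(x,y,t):x,y\in\mathbb{R}\}$. The generating curve is maximal: $(y,z,\theta)$ is a smooth solution, on its maximal open interval of existence, of the ODE system given by $y'=e^z\cos\theta$, $z'=\sin\theta$ and the curvature condition. "Up to integration constants" means: up to reparametrizations $s\mapsto\pm s+s_0$ of $\alpha$ and up to the isometries of Sol $(x,y,z)\mapsto(x,y+b,z)$, $(x,y,z)\mapsto(e^{\lambda}x,e^{-\lambda}y,z-\lambda)$ and $(x,y,z)\mapsto(x,-y,z)$. *)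

theory Defs
  imports "HOL-Analysis.Analysis"
begin

section \<open>Gaussian curvature of a Riemannian metric in local coordinates\<close>

definition partial_deriv :: "'n::finite \<Rightarrow> (real^'n \<Rightarrow> 'b::real_normed_vector) \<Rightarrow> real^'n \<Rightarrow> 'b" where
  "partial_deriv i f p = vector_derivative (\<lambda>h. f (p + h *\<^sub>R axis i 1)) (at 0)"

text \<open>\<open>christoffel g k i j\<close> is $\Gamma^k_{ij}$, and \<open>riemann g l k i j\<close> is the
  coefficient $R^l{}_{kij}$ in $R(\partial_i,\partial_j)\partial_k = \sum_l R^l{}_{kij}\,\partial_l$,
  where $R(X,Y) = \nabla_X\nabla_Y - \nabla_Y\nabla_X - \nabla_{[X,Y]}$.\<close>

definition christoffel :: "(real^'n \<Rightarrow> real^'n^'n) \<Rightarrow> 'n::finite \<Rightarrow> 'n \<Rightarrow> 'n \<Rightarrow> real^'n \<Rightarrow> real" where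
  "christoffel g k i j p =
     (\<Sum>l\<in>UNIV. matrix_inv (g p) $ k $ l *
        (partial_deriv i (\<lambda>q. g q $ j $ l) p + partial_deriv j (\<lambda>q. g q $ i $ l) p
          - partial_deriv l (\<lambda>q. g q $ i $ j) p)) / 2"

definition riemann :: "(real^'n \<Rightarrow> real^'n^'n) \<Rightarrow> 'n::finite \<Rightarrow> 'n \<Rightarrow> 'n \<Rightarrow> 'n \<Rightarrow> real^'n \<Rightarrow> real" where
  "riemann g l k i j p =
     partial_deriv i (christoffel g l j k) p - partial_deriv j (christoffel g l i k) p
     + (\<Sum>m\<in>UNIV. christoffel g m j k p * christoffel g l i m p
                  - christoffel g m i k p * christoffel g l j m p)"

text \<open>$K = \langle R(\partial_1,\partial_2)\partial_2,\partial_1\rangle / \det g$.\<close>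

definition gauss_curvature :: "(real^2 \<Rightarrow> real^2^2) \<Rightarrow> real^2 \<Rightarrow> real" where
  "gauss_curvature g p = (\<Sum>l\<in>UNIV. g p $ 1 $ l * riemann g l 2 1 2 p) / det (g p)"

section \<open>Invariant surfaces in Sol\<close>

definition sol_metric :: "real^3 \<Rightarrow> real^3 \<Rightarrow> real^3 \<Rightarrow> real" where
  "sol_metric p u v = exp (2 * p$3) * u$1 * v$1 + exp (- 2 * p$3) * u$2 * v$2 + u$3 * v$3"

definition induced_metric :: "(real^2 \<Rightarrow> real^3) \<Rightarrow> real^2 \<Rightarrow> real^2^2" where
  "induced_metric X p =
     (\<chi> i j. sol_metric (X p) (partial_deriv i X p) (partial_deriv j X p))"

definition gen_curve :: "(real \<Rightarrow> real) \<Rightarrow> (real \<Rightarrow> real) \<Rightarrow> real \<Rightarrow> real^3" where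
  "gen_curve y z s = vector [0, y s, z s]"

text \<open>The parameter point is \<open>(s, t)\<close>: its first coordinate is the arc length of the generating
  curve, its second one the parameter of the group of translations in the \<open>x\<close>-direction.\<close>

definition surface_param :: "(real \<Rightarrow> real) \<Rightarrow> (real \<Rightarrow> real) \<Rightarrow> real^2 \<Rightarrow> real^3" where
  "surface_param y z p = vector [p$2, y (p$1), z (p$1)]"

definition invariant_surface :: "real set \<Rightarrow> (real \<Rightarrow> real) \<Rightarrow> (real \<Rightarrow> real) \<Rightarrow> (real^3) set" where
  "invariant_surface I y z = surface_param y z ` {p. p$1 \<in> I}"

definition smooth_on_open :: "real set \<Rightarrow> (real \<Rightarrow> real) \<Rightarrow> bool" where
  "smooth_on_open I f \<longleftrightarrow> (\<forall>n. \<forall>s\<in>I. (deriv ^^ n) f differentiable (at s))"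

definition cgc_solution ::
  "real \<Rightarrow> real set \<Rightarrow> (real \<Rightarrow> real) \<Rightarrow> (real \<Rightarrow> real) \<Rightarrow> (real \<Rightarrow> real) \<Rightarrow> bool" where
  "cgc_solution c I y z \<theta> \<longleftrightarrow>
     open I \<and> is_interval I \<and> I \<noteq> {} \<and>
     smooth_on_open I y \<and> smooth_on_open I z \<and> smooth_on_open I \<theta> \<and>
     (\<forall>s\<in>I. (y has_real_derivative exp (z s) * cos (\<theta> s)) (at s)) \<and>
     (\<forall>s\<in>I. (z has_real_derivative sin (\<theta> s)) (at s)) \<and>
     (\<forall>s\<in>I. \<forall>t. gauss_curvature (induced_metric (surface_param y z)) (vector [s, t]) = c)"

definition maximal_cgc_solution ::
  "real \<Rightarrow> real set \<Rightarrow> (real \<Rightarrow> real) \<Rightarrow> (real \<Rightarrow> real) \<Rightarrow> (real \<Rightarrow> real) \<Rightarrow> bool" where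
  "maximal_cgc_solution c I y z \<theta> \<longleftrightarrow>
     cgc_solution c I y z \<theta> \<and>
     (\<forall>J y' z' \<theta>'. cgc_solution c J y' z' \<theta>' \<and> I \<subseteq> J \<and>
        (\<forall>s\<in>I. y' s = y s \<and> z' s = z s \<and> \<theta>' s = \<theta> s) \<longrightarrow> J = I)"

definition foliation2 :: "(real^3) set set" where
  "foliation2 = range (\<lambda>t. {p. p$2 = t})"

definition foliation3 :: "(real^3) set set" where
  "foliation3 = range (\<lambda>t. {p. p$3 = t})"

subsection \<open>The curvature of an invariant surface\<close>

lemma matrix_inv_unique: fixes A B :: "real^'n^'n" assumes "A ** B = mat 1" "B ** A = mat 1" shows "matrix_inv A = B"
proof -
  have "A ** matrix_inv A = mat 1 \<and> matrix_inv A ** A = mat 1"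
    unfolding matrix_inv_def by (rule someI[of _ B]) (use assms in auto)
  then have "matrix_inv A = (B ** A) ** matrix_inv A" using assms by simp
  also have "\<dots> = B" using \<open>_ \<and> _\<close> by (metis matrix_mul_assoc matrix_mul_rid)
  finally show ?thesis .
qed

lemma partial_deriv_first_coord:
  fixes F :: "real \<Rightarrow> 'b::real_normed_vector" and p :: "real^2"
  assumes I: "open I" "p$1 \<in> I" and eq: "\<And>q. q$1 \<in> I \<Longrightarrow> f q = F (q$1)"
    and d: "(F has_vector_derivative D) (at (p$1))"
  shows "partial_deriv 1 f p = D" "partial_deriv 2 f p = 0"
proof -
  have "((\<lambda>h. p$1 + h) has_vector_derivative 1) (at 0)"
    by (auto intro!: derivative_eq_intros)
  from vector_diff_chain_at[OF this, of F D] d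
  have "(F \<circ> (\<lambda>h. p$1 + h) has_vector_derivative D) (at 0)" by simp
  moreover have "\<forall>\<^sub>F h in nhds 0. p$1 + h \<in> I"
  proof -
    have "((\<lambda>h. p$1 + h) \<longlongrightarrow> p$1 + 0) (nhds 0)" by (intro tendsto_intros) (simp add: filterlim_def)
    then show ?thesis using I by (simp add: tendsto_def)
  qed
  then have "\<forall>\<^sub>F h in nhds 0. (F \<circ> (\<lambda>h. p$1 + h)) h = f (p + h *\<^sub>R axis 1 1)"
    by eventually_elim (simp add: eq axis_def)
  ultimately have "((\<lambda>h. f (p + h *\<^sub>R axis 1 1)) has_vector_derivative D) (at 0)"
    using has_vector_derivative_cong_ev[of UNIV "F \<circ> (\<lambda>h. p$1 + h)" "\<lambda>h. f (p + h *\<^sub>R axis 1 1)" 0 D]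
    by (auto dest: eventually_nhds_x_imp_x)
  then show "partial_deriv 1 f p = D" unfolding partial_deriv_def by (rule vector_derivative_at)
  have "(\<lambda>h. f (p + h *\<^sub>R axis 2 1)) = (\<lambda>h. F (p$1))" 
    using I by (intro ext) (simp add: eq axis_def)
  then show "partial_deriv 2 f p = 0" unfolding partial_deriv_def
    by (simp)
qed

lemma has_vector_derivative_vector3: assumes "(f has_real_derivative a) (at x)" "(g has_real_derivative b) (at x)" "(h has_real_derivative d) (at x)"
  shows "((\<lambda>x. vector [f x, g x, h x] :: real^3) has_vector_derivative vector [a,b,d]) (at x)"
proof -
  have e: "vector [p,q,r] = p *\<^sub>R axis 1 1 + q *\<^sub>R axis 2 1 + r *\<^sub>R (axis 3 1 :: real^3)" for p q r :: real
    by (simp add: vec_eq_iff forall_3 axis_def)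
  show ?thesis unfolding e using assms
    by (auto intro!: derivative_eq_intros simp: has_real_derivative_iff_has_vector_derivative)
qed

theorem gauss_curvature_invariant_surface: assumes I: "open I" 
  and y: "\<And>s. s \<in> I \<Longrightarrow> (y has_real_derivative exp (z s) * cos (\<theta> s)) (at s)"
  and z: "\<And>s. s \<in> I \<Longrightarrow> (z has_real_derivative sin (\<theta> s)) (at s)"
  and th: "\<And>s. s \<in> I \<Longrightarrow> (\<theta> has_real_derivative \<theta>' s) (at s)"
  and s: "s \<in> I"
 shows "gauss_curvature (induced_metric (surface_param y z)) (vector [s, t]) = - \<theta>' s * cos (\<theta> s) - (sin (\<theta> s))\<^sup>2"
proof -
  let ?X = "surface_param y z"
  let ?g = "induced_metric ?X"
  define zz where "zz = (\<lambda>x. sin (\<theta> x))"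
  have P1: "partial_deriv 1 ?X p = vector [0, exp (z (p$1)) * cos (\<theta> (p$1)), sin (\<theta> (p$1))]" if "p$1 \<in> I" for p
  proof -
    have "(\<lambda>h. ?X (p + h *\<^sub>R axis 1 1)) = (\<lambda>h. vector [p$2, y (p$1+h), z (p$1+h)])"
      by (auto simp: surface_param_def axis_def fun_eq_iff)
    moreover have "((\<lambda>h. y (p$1+h)) has_real_derivative exp (z (p$1)) * cos (\<theta> (p$1))) (at 0)"
      "((\<lambda>h. z (p$1+h)) has_real_derivative sin (\<theta> (p$1))) (at 0)"
      using y[OF that] z[OF that] DERIV_shift[of y _ 0 "p$1"] DERIV_shift[of z _ 0 "p$1"] by (simp_all only: add_0_right add_0 add.commute[of _ "p$1"])
    ultimately show ?thesis unfolding partial_deriv_def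
      by (simp) (intro vector_derivative_at has_vector_derivative_vector3, auto)
  qed
  have P2: "partial_deriv 2 ?X p = vector [1, 0, 0]" for p
  proof -
    have "(\<lambda>h. ?X (p + h *\<^sub>R axis 2 1)) = (\<lambda>h. vector [p$2 + h, y (p$1), z (p$1)])"
      by (auto simp: surface_param_def axis_def fun_eq_iff)
    then show ?thesis unfolding partial_deriv_def
      by simp (intro vector_derivative_at has_vector_derivative_vector3, auto intro!: derivative_eq_intros)
  qed
  have g: "?g p = (\<chi> i j. if i = j then (if i = 1 then 1 else exp (2 * z (p$1))) else 0)" if "p$1 \<in> I" for p
  proof -
    have "exp (-2 * z (p$1)) * (exp (z (p$1)) * cos (\<theta> (p$1))) * (exp (z (p$1)) * cos (\<theta> (p$1))) = (cos (\<theta> (p$1)))\<^sup>2 * (exp (-2 * z (p$1)) * exp (z (p$1)) * exp (z (p$1)))"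
      by (simp add: power2_eq_square)
    also have "exp (-2 * z (p$1)) * exp (z (p$1)) * exp (z (p$1)) = 1" by (simp flip: exp_add)
    finally show ?thesis using that
    by (auto simp: vec_eq_iff forall_2 induced_metric_def sol_metric_def P1 P2 surface_param_def)
     (simp add: power2_eq_square[symmetric])
  qed
  have gi: "matrix_inv (?g p) = (\<chi> i j. if i = j then (if i = 1 then 1 else exp (- 2 * z (p$1))) else 0)" if "p$1 \<in> I" for p
    unfolding g[OF that]
    by (rule matrix_inv_unique) (auto simp: matrix_matrix_mult_def vec_eq_iff forall_2 sum_2 mat_def simp flip: exp_add)
  have dE: "((\<lambda>s. exp (2 * z s)) has_vector_derivative 2 * sin (\<theta> s) * exp (2 * z s)) (at s)" if "s \<in> I" for s
    unfolding has_real_derivative_iff_has_vector_derivative[symmetric] 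
    using z[OF that] by (auto intro!: derivative_eq_intros)
  have d22: "partial_deriv 1 (\<lambda>q. ?g q $ 2 $ 2) p = 2 * sin (\<theta> (p$1)) * exp (2 * z (p$1))"
     "partial_deriv 2 (\<lambda>q. ?g q $ 2 $ 2) p = 0" if "p$1 \<in> I" for p
    by (rule partial_deriv_first_coord[OF I that _ dE[OF that]], simp add: g)+
  have d11: "partial_deriv 1 (\<lambda>q. ?g q $ 1 $ 1) p = 0" "partial_deriv 2 (\<lambda>q. ?g q $ 1 $ 1) p = 0"
     if "p$1 \<in> I" for p
    by (rule partial_deriv_first_coord[OF I that _ has_vector_derivative_const[of 1]], simp add: g)+
  have d12: "partial_deriv 1 (\<lambda>q. ?g q $ 1 $ 2) p = 0" "partial_deriv 2 (\<lambda>q. ?g q $ 1 $ 2) p = 0"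
     "partial_deriv 1 (\<lambda>q. ?g q $ 2 $ 1) p = 0" "partial_deriv 2 (\<lambda>q. ?g q $ 2 $ 1) p = 0" if "p$1 \<in> I" for p
    by (rule partial_deriv_first_coord[OF I that _ has_vector_derivative_const[of 0]], simp add: g)+
  note dd = d11 d12 d22
  have C: "christoffel ?g 1 2 2 p = - sin (\<theta> (p$1)) * exp (2 * z (p$1))"
      "christoffel ?g 2 1 2 p = sin (\<theta> (p$1))" "christoffel ?g 2 2 1 p = sin (\<theta> (p$1))"
      "christoffel ?g 1 1 2 p = 0" "christoffel ?g 1 2 1 p = 0" "christoffel ?g 1 1 1 p = 0" "christoffel ?g 2 1 1 p = 0"
      "christoffel ?g 2 2 2 p = 0"
     if "p$1 \<in> I" for p
    by (simp_all add: christoffel_def sum_2 dd[OF that] gi[OF that])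
      (simp_all add: exp_minus)
  let ?p = "vector [s, t] :: real^2"
  have dC: "((\<lambda>s. - sin (\<theta> s) * exp (2 * z s)) has_vector_derivative - (cos (\<theta> s) * \<theta>' s + 2 * (sin (\<theta> s))\<^sup>2) * exp (2 * z s)) (at s)"
    unfolding has_real_derivative_iff_has_vector_derivative[symmetric] 
    using z[OF s] th[OF s] by (auto intro!: derivative_eq_intros simp: algebra_simps power2_eq_square)
  have 1: "partial_deriv 1 (christoffel ?g 1 2 2) ?p = - (cos (\<theta> s) * \<theta>' s + 2 * (sin (\<theta> s))\<^sup>2) * exp (2 * z s)"
    using dC s by (intro partial_deriv_first_coord(1)[OF I]) (auto simp: C)
  have 2: "partial_deriv 2 (christoffel ?g 1 1 2) ?p = 0"
    by (rule partial_deriv_first_coord(2)[OF I _ _ has_vector_derivative_const[of 0]]) (auto simp: C s)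
  have p: "?p$1 \<in> I" using s by simp
  show ?thesis
    by (simp add: gauss_curvature_def riemann_def sum_2 det_2 g[OF p] C[OF p] 1 2)
     (simp add: field_simps power2_eq_square)
qed

section \<open>Equality up to integration constants\<close>

inductive_set integration_isometries :: "(real^3 \<Rightarrow> real^3) set" where
  ident: "id \<in> integration_isometries"
| translate: "\<Phi> \<in> integration_isometries \<Longrightarrow>
    (\<lambda>p. vector [p$1, p$2 + b, p$3]) \<circ> \<Phi> \<in> integration_isometries"
| dilate: "\<Phi> \<in> integration_isometries \<Longrightarrow>
    (\<lambda>p. vector [exp l * p$1, exp (- l) * p$2, p$3 - l]) \<circ> \<Phi> \<in> integration_isometries"
| reflect: "\<Phi> \<in> integration_isometries \<Longrightarrow>
    (\<lambda>p. vector [p$1, - p$2, p$3]) \<circ> \<Phi> \<in> integration_isometries"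

definition up_to_integration_constants ::
  "real set \<Rightarrow> (real \<Rightarrow> real^3) \<Rightarrow> real set \<Rightarrow> (real \<Rightarrow> real^3) \<Rightarrow> bool" where
  "up_to_integration_constants I \<alpha> J \<beta> \<longleftrightarrow>
     (\<exists>\<epsilon> s0 \<Phi>. \<epsilon> \<in> {1, -1} \<and> \<Phi> \<in> integration_isometries \<and>
        J = {s. \<epsilon> * s + s0 \<in> I} \<and> (\<forall>s\<in>J. \<beta> s = \<Phi> (\<alpha> (\<epsilon> * s + s0))))"

section \<open>Graphs in the plane x = 0\<close>

definition is_graph :: "real set \<Rightarrow> (real \<Rightarrow> real^3) \<Rightarrow> (real \<Rightarrow> real) \<Rightarrow> real set \<Rightarrow> bool" where
  "is_graph J \<beta> f D \<longleftrightarrow> \<beta> ` J = {vector [0, v, f v] | v. v \<in> D}"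

definition local_min_at :: "(real \<Rightarrow> real) \<Rightarrow> real set \<Rightarrow> real \<Rightarrow> bool" where
  "local_min_at f D v \<longleftrightarrow> v \<in> D \<and> (\<forall>\<^sub>F w in at v within D. f v \<le> f w)"

definition local_extremum_at :: "(real \<Rightarrow> real) \<Rightarrow> real set \<Rightarrow> real \<Rightarrow> bool" where
  "local_extremum_at f D v \<longleftrightarrow> local_min_at f D v \<or> local_min_at (\<lambda>w. - f w) D v"

text \<open>A single minimum is a global minimum that is the only local extremum.\<close>

definition single_minimum :: "(real \<Rightarrow> real) \<Rightarrow> real set \<Rightarrow> bool" where
  "single_minimum f D \<longleftrightarrow>
     (\<exists>v\<in>D. (\<forall>w\<in>D. f v \<le> f w) \<and> (\<forall>w. local_extremum_at f D w \<longrightarrow> w = v))"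

definition single_maximum :: "(real \<Rightarrow> real) \<Rightarrow> real set \<Rightarrow> bool" where
  "single_maximum f D \<longleftrightarrow> single_minimum (\<lambda>w. - f w) D"

text \<open>The tangent line of \<open>\<beta>\<close> tends to the \<open>z\<close>-direction as the \<open>y\<close>-coordinate of \<open>\<beta>\<close> tends
  to \<open>e\<close>; the absolute value removes the orientation of the unit tangent vector.\<close>

definition vertical_towards :: "real set \<Rightarrow> (real \<Rightarrow> real^3) \<Rightarrow> real \<Rightarrow> bool" where
  "vertical_towards J \<beta> e \<longleftrightarrow>
     ((\<lambda>s. \<bar>sgn (vector_derivative \<beta> (at s)) $ 3\<bar>) \<longlongrightarrow> 1)
       (inf (filtercomap (\<lambda>s. \<beta> s $ 2) (at e)) (principal J))"

end

theory Submission
  imports Defs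
begin

text \<open>
  The classification comes from a linear equation hidden in the curvature condition. Along the
  generating curve \<open>z' = sin \<theta>\<close>, and \<open>K = c\<close> reads \<open>z'' + z'\<^sup>2 = - c\<close>; hence \<open>u = exp z\<close>
  solves \<open>u'' = - c u\<close> (\<open>cgc_solution_exp_ode\<close>). The angle only imposes the inequality \<open>\<bar>u'\<bar> \<le> u\<close>, because
  \<open>sin \<theta> = u' / u\<close>, and \<open>y\<close> is recovered by integrating \<open>y' = exp z cos \<theta>\<close>, which up to sign is
  \<open>sqrt (u\<^sup>2 - u'\<^sup>2)\<close>.

  If \<open>cos \<theta>\<close> vanishes somewhere, then \<open>c = - 1\<close>, \<open>cos \<theta>\<close> vanishes everywhere, and the surface is a leaf
  \<open>y = const\<close> (\<open>leaf_of_foliation2\<close>). Otherwise \<open>\<bar>u'\<bar> < u\<close> on the parameter interval, and maximality says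
  that this interval is a whole connected component of the set where a global solution of the linear equation
  satisfies the strict inequality: inside such a component \<open>z\<close>, \<open>\<theta>\<close> and \<open>y\<close> can be written down from \<open>u\<close>. So
  up to affine reparametrization and the isometries the curve is determined by a pair of a solution \<open>w\<close>
  and a component \<open>J\<close>, called a profile here (\<open>maximal_solution_from_profile\<close>,
  \<open>profile_up_to_integration_constants\<close>).

  The value of \<open>u' / u\<close> at one point selects the profile. With \<open>k = sqrt \<bar>c\<bar>\<close> it is \<open>1\<close> or \<open>s\<close> for
  \<open>c = 0\<close>, \<open>cos (k s)\<close> for \<open>c > 0\<close>, and one of \<open>cosh (k s)\<close>, \<open>exp (k s)\<close>, \<open>sinh (k s)\<close> for \<open>c < 0\<close>; for \<open>c = - 1\<close> and \<open>c < - 1\<close>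
  only \<open>cosh (k s)\<close> is compatible with the strict inequality. The interval \<open>J\<close> is bounded exactly for
  \<open>c > 0\<close> and \<open>c < - 1\<close>, and at its ends \<open>\<bar>u'\<bar> = u\<close>, that is, the curve becomes vertical
  (\<open>bounded_profile_graph\<close>). The monotonicity of \<open>w\<close> and the growth of the antiderivative of
  \<open>sqrt (w\<^sup>2 - w'\<^sup>2)\<close> then give the shape of the graph.
\<close>

section \<open>Smoothness from closure under differentiation\<close>

text \<open>Every iterated derivative of \<open>f\<close> agrees on \<open>I\<close> with a member of the family \<open>F\<close>, so it can be
  differentiated once more. No rule for iterated derivatives of products or compositions is
  involved.\<close>

lemma smooth_on_open_if_closed_under_deriv:
  assumes "open I" and f: "f \<in> F"
    and closed: "\<And>f. f \<in> F \<Longrightarrow> \<exists>g\<in>F. \<forall>s\<in>I. (f has_real_derivative g s) (at s)"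
  shows "smooth_on_open I f"
proof -
  have transfer: "(h has_real_derivative D) (at s)"
    if "\<forall>s\<in>I. h s = g s" "s \<in> I" "(g has_real_derivative D) (at s)" for h g :: "real \<Rightarrow> real" and D s
    using has_field_derivative_transform_within_open[OF that(3) \<open>open I\<close> that(2), of h] that(1) by auto
  have "\<exists>g\<in>F. \<forall>s\<in>I. (deriv ^^ n) f s = g s" for n
  proof (induction n)
    case 0
    then show ?case using f by auto
  next
    case (Suc n)
    then obtain g where g: "g \<in> F" "\<forall>s\<in>I. (deriv ^^ n) f s = g s" by blast
    obtain g' where g': "g' \<in> F" "\<forall>s\<in>I. (g has_real_derivative g' s) (at s)"
      using closed[OF g(1)] by blast
    have "\<forall>s\<in>I. (deriv ^^ Suc n) f s = g' s"
      using transfer[OF g(2)] g'(2) by (auto intro!: DERIV_imp_deriv)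
    with g'(1) show ?case by blast
  qed
  then show ?thesis unfolding smooth_on_open_def
    using transfer closed by (metis real_differentiable_def)
qed

inductive_set generated_algebra :: "(real \<Rightarrow> real) set \<Rightarrow> (real \<Rightarrow> real) set"
  for G :: "(real \<Rightarrow> real) set" where
  generator: "g \<in> G \<Longrightarrow> g \<in> generated_algebra G"
| const: "(\<lambda>_. a) \<in> generated_algebra G"
| add: "f \<in> generated_algebra G \<Longrightarrow> g \<in> generated_algebra G \<Longrightarrow> (\<lambda>s. f s + g s) \<in> generated_algebra G"
| mult: "f \<in> generated_algebra G \<Longrightarrow> g \<in> generated_algebra G \<Longrightarrow> (\<lambda>s. f s * g s) \<in> generated_algebra G"

text \<open>A system of first-order equations whose right-hand sides are polynomials in the unknowns has
  smooth solutions: the algebra that the unknowns generate is closed under differentiation.\<close>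

lemma smooth_on_open_generator:
  assumes "open I" "f \<in> G"
    and G: "\<And>g. g \<in> G \<Longrightarrow> \<exists>g'\<in>generated_algebra G. \<forall>s\<in>I. (g has_real_derivative g' s) (at s)"
  shows "smooth_on_open I f"
proof (rule smooth_on_open_if_closed_under_deriv[OF \<open>open I\<close> generated_algebra.generator[OF \<open>f \<in> G\<close>]])
  fix h assume "h \<in> generated_algebra G"
  then show "\<exists>g\<in>generated_algebra G. \<forall>s\<in>I. (h has_real_derivative g s) (at s)"
  proof induction
    case (generator g)
    then show ?case by (rule G)
  next
    case (const a)
    show ?case by (rule bexI[OF _ generated_algebra.const[of 0]]) auto
  next
    case (add f g)
    then obtain f' g' where *: "f' \<in> generated_algebra G" "\<forall>s\<in>I. (f has_real_derivative f' s) (at s)"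
      "g' \<in> generated_algebra G" "\<forall>s\<in>I. (g has_real_derivative g' s) (at s)" by blast
    show ?case
      by (rule bexI[OF _ generated_algebra.add[OF *(1,3)]]) (use * in \<open>auto intro!: derivative_eq_intros\<close>)
  next
    case (mult f g)
    then obtain f' g' where *: "f' \<in> generated_algebra G" "\<forall>s\<in>I. (f has_real_derivative f' s) (at s)"
      "g' \<in> generated_algebra G" "\<forall>s\<in>I. (g has_real_derivative g' s) (at s)" by blast
    have "(\<lambda>s. f' s * g s + g' s * f s) \<in> generated_algebra G"
      using mult.hyps *(1,3) by (intro generated_algebra.add generated_algebra.mult)
    then show ?case
      by (rule bexI[rotated]) (use * in \<open>auto intro!: DERIV_mult\<close>)
  qed
qed

section \<open>The curvature equation\<close>

lemma cgc_solution_angle_ode: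
  assumes "cgc_solution c I y z \<theta>" "s \<in> I"
  shows "(\<theta> has_real_derivative deriv \<theta> s) (at s)"
    and "deriv \<theta> s * cos (\<theta> s) = - c - (sin (\<theta> s))\<^sup>2"
proof -
  have d: "(\<theta> has_real_derivative deriv \<theta> s) (at s)" if "s \<in> I" for s
  proof -
    have "(deriv ^^ 0) \<theta> differentiable (at s)"
      using assms(1) that unfolding cgc_solution_def smooth_on_open_def by blast
    then show ?thesis by (simp add: DERIV_deriv_iff_real_differentiable)
  qed
  then show "(\<theta> has_real_derivative deriv \<theta> s) (at s)" using assms(2) by blast
  have "gauss_curvature (induced_metric (surface_param y z)) (vector [s, 0]) = c"
    using assms unfolding cgc_solution_def by blast
  moreover have "gauss_curvature (induced_metric (surface_param y z)) (vector [s, 0])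
      = - deriv \<theta> s * cos (\<theta> s) - (sin (\<theta> s))\<^sup>2"
    by (rule gauss_curvature_invariant_surface[of I])
      (use assms d in \<open>auto simp: cgc_solution_def\<close>)
  ultimately show "deriv \<theta> s * cos (\<theta> s) = - c - (sin (\<theta> s))\<^sup>2" by simp
qed

text \<open>The three unknowns together with \<open>exp z\<close>, \<open>sin \<theta>\<close>, \<open>cos \<theta>\<close> and \<open>1 / cos \<theta>\<close> satisfy a polynomial
  system, so smoothness follows from the first derivatives alone. This is how a
  candidate for an extension of a given solution is recognised as a solution.\<close>

lemma cgc_solutionI:
  assumes I: "open I" "is_interval I" "I \<noteq> {}"
    and y: "\<And>s. s \<in> I \<Longrightarrow> (y has_real_derivative exp (z s) * cos (\<theta> s)) (at s)"
    and z: "\<And>s. s \<in> I \<Longrightarrow> (z has_real_derivative sin (\<theta> s)) (at s)"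
    and th: "\<And>s. s \<in> I \<Longrightarrow> (\<theta> has_real_derivative (- c - (sin (\<theta> s))\<^sup>2) / cos (\<theta> s)) (at s)"
    and cos: "\<And>s. s \<in> I \<Longrightarrow> cos (\<theta> s) \<noteq> 0"
  shows "cgc_solution c I y z \<theta>"
proof -
  define E S C R where "E = (\<lambda>s. exp (z s))" and "S = (\<lambda>s. sin (\<theta> s))"
    and "C = (\<lambda>s. cos (\<theta> s))" and "R = (\<lambda>s. 1 / cos (\<theta> s))"
  note defs = E_def S_def C_def R_def
  define G where "G = {y, z, \<theta>, E, S, C, R}"
  define T where "T = (\<lambda>s. (- c + (- 1) * (S s * S s)) * R s)"
  have gen: "E \<in> generated_algebra G" "S \<in> generated_algebra G" "C \<in> generated_algebra G"
    "R \<in> generated_algebra G"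
    by (auto simp: G_def intro: generated_algebra.generator)
  have T: "T \<in> generated_algebra G" unfolding T_def
    by (intro generated_algebra.add generated_algebra.mult generated_algebra.const gen)
  have th': "(\<theta> has_real_derivative T s) (at s)" if "s \<in> I" for s
    using th[OF that] by (simp add: T_def defs power2_eq_square)
  have closed: "\<exists>g'\<in>generated_algebra G. \<forall>s\<in>I. (g has_real_derivative g' s) (at s)" if "g \<in> G" for g
  proof -
    have witness: ?thesis
      if "g' \<in> generated_algebra G" "\<And>s. s \<in> I \<Longrightarrow> (g has_real_derivative g' s) (at s)" for g'
      using that by blast
    note closure = generated_algebra.mult generated_algebra.const gen T
    from that consider "g = y" | "g = z" | "g = \<theta>" | "g = E" | "g = S" | "g = C" | "g = R"
      by (auto simp: G_def)
    then show ?thesis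
    proof cases
      case 1
      have "(\<lambda>s. E s * C s) \<in> generated_algebra G" by (intro closure)
      then show ?thesis by (rule witness) (use y in \<open>simp add: 1 defs\<close>)
    next
      case 2
      show ?thesis by (rule witness[OF gen(2)]) (use z in \<open>simp add: 2 defs\<close>)
    next
      case 3
      show ?thesis by (rule witness[OF T]) (use th' in \<open>simp add: 3\<close>)
    next
      case 4
      have "(\<lambda>s. E s * S s) \<in> generated_algebra G" by (intro closure)
      then show ?thesis
        by (rule witness) (use z in \<open>auto simp: 4 defs intro!: derivative_eq_intros\<close>)
    next
      case 5
      have "(\<lambda>s. C s * T s) \<in> generated_algebra G" by (intro closure)
      then show ?thesis
        by (rule witness) (use th' in \<open>auto simp: 5 S_def C_def intro!: derivative_eq_intros\<close>)
    next
      case 6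
      have "(\<lambda>s. (- 1) * (S s * T s)) \<in> generated_algebra G" by (intro closure)
      then show ?thesis
        by (rule witness) (use th' in \<open>auto simp: 6 S_def C_def intro!: derivative_eq_intros\<close>)
    next
      case 7
      have "(\<lambda>s. R s * R s * (S s * T s)) \<in> generated_algebra G" by (intro closure)
      then show ?thesis
        by (rule witness) (use th' cos in \<open>auto simp: 7 S_def R_def field_simps power2_eq_square
            intro!: derivative_eq_intros\<close>)
    qed
  qed
  have "smooth_on_open I f" if "f \<in> G" for f
    by (rule smooth_on_open_generator[OF I(1) that closed])
  then have "smooth_on_open I y" "smooth_on_open I z" "smooth_on_open I \<theta>"
    by (auto simp: G_def)
  moreover have "gauss_curvature (induced_metric (surface_param y z)) (vector [s, t]) = c" if "s \<in> I" for s t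
    using gauss_curvature_invariant_surface[OF I(1) y z th that, of t] cos[OF that]
    by (simp add: field_simps)
  ultimately show ?thesis using I y z unfolding cgc_solution_def by blast
qed

lemma abs_sin_less_1: "cos x \<noteq> 0 \<Longrightarrow> \<bar>sin x\<bar> < 1" for x :: real
  by (simp add: sin_squared_eq flip: abs_square_less_1)

text \<open>Uniqueness for \<open>d'' = - c d\<close>: the energy \<open>d\<^sup>2 + d'\<^sup>2\<close> grows or decays at most exponentially, so it vanishes
  everywhere once it vanishes at one point.\<close>

lemma linear_ode_zero:
  fixes d d' :: "real \<Rightarrow> real"
  assumes I: "is_interval I" and p: "p \<in> I" and s: "s \<in> I"
    and d: "\<And>s. s \<in> I \<Longrightarrow> (d has_real_derivative d' s) (at s)"
    and d': "\<And>s. s \<in> I \<Longrightarrow> (d' has_real_derivative - c * d s) (at s)"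
    and init: "d p = 0" "d' p = 0"
  shows "d s = 0" "d' s = 0"
proof -
  define E where "E = (\<lambda>s. (d s)\<^sup>2 + (d' s)\<^sup>2)"
  define K where "K = \<bar>1 - c\<bar>"
  define E' where "E' = (\<lambda>s. 2 * (1 - c) * (d s * d' s))"
  have E: "(E has_real_derivative E' s) (at s)" if "s \<in> I" for s
    unfolding E_def E'_def using d[OF that] d'[OF that]
    by (auto intro!: derivative_eq_intros simp: algebra_simps)
  have bound: "\<bar>E' s\<bar> \<le> K * E s" for s
  proof -
    have "\<bar>2 * (d s * d' s)\<bar> \<le> E s"
      using sum_squares_bound[of "\<bar>d s\<bar>" "\<bar>d' s\<bar>"] by (simp add: E_def abs_mult)
    then have "K * \<bar>2 * (d s * d' s)\<bar> \<le> K * E s" by (intro mult_left_mono) (auto simp: K_def)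
    moreover have "E' s = (1 - c) * (2 * (d s * d' s))" by (simp add: E'_def)
    then have "\<bar>E' s\<bar> = K * \<bar>2 * (d s * d' s)\<bar>" unfolding K_def by (simp only: abs_mult)
    ultimately show ?thesis by simp
  qed
  have sub: "x \<in> I" if "u \<in> I" "v \<in> I" "u \<le> x" "x \<le> v" for u v x
    using that I by (meson mem_is_interval_1_I)
  have "E s \<le> 0"
  proof (cases "p \<le> s")
    case True
    have "E s * exp (- K * s) \<le> E p * exp (- K * p)"
    proof (rule DERIV_nonpos_imp_nonincreasing[OF True])
      fix x assume "p \<le> x" "x \<le> s"
      then have "x \<in> I" using sub p s by blast
      then have "((\<lambda>s. E s * exp (- K * s)) has_real_derivative (E' x - K * E x) * exp (- K * x)) (at x)"
        using E by (auto intro!: derivative_eq_intros simp: algebra_simps)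
      moreover have "(E' x - K * E x) * exp (- K * x) \<le> 0"
        using bound[of x] by (intro mult_nonpos_nonneg) auto
      ultimately show "\<exists>y. ((\<lambda>s. E s * exp (- K * s)) has_real_derivative y) (at x) \<and> y \<le> 0" by blast
    qed
    then show ?thesis using init by (simp add: E_def mult_le_0_iff)
  next
    case False
    then have le: "s \<le> p" by simp
    have "E s * exp (K * s) \<le> E p * exp (K * p)"
    proof (rule DERIV_nonneg_imp_nondecreasing[OF le])
      fix x assume "s \<le> x" "x \<le> p"
      then have "x \<in> I" using sub p s by blast
      then have "((\<lambda>s. E s * exp (K * s)) has_real_derivative (E' x + K * E x) * exp (K * x)) (at x)"
        using E by (auto intro!: derivative_eq_intros simp: algebra_simps)
      moreover have "(E' x + K * E x) * exp (K * x) \<ge> 0"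
        using bound[of x] by (intro mult_nonneg_nonneg) auto
      ultimately show "\<exists>y. ((\<lambda>s. E s * exp (K * s)) has_real_derivative y) (at x) \<and> 0 \<le> y" by blast
    qed
    then show ?thesis using init by (simp add: E_def mult_le_0_iff)
  qed
  then have "d s ^ 2 = 0 \<and> d' s ^ 2 = 0"
    unfolding E_def by (smt (verit) zero_le_power2)
  then show "d s = 0" "d' s = 0" by auto
qed

text \<open>The linearisation on which everything rests. From \<open>z' = sin \<theta>\<close> and \<open>\<theta>' cos \<theta> = - c - sin\<^sup>2 \<theta>\<close> one gets
  \<open>z'' + z'\<^sup>2 = - c\<close>, a Riccati equation for \<open>z'\<close>, and its solutions are logarithmic derivatives of
  solutions \<open>u = exp z\<close> of \<open>u'' = - c u\<close>.\<close>

lemma cgc_solution_exp_ode: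
  assumes "cgc_solution c I y z \<theta>" "s \<in> I"
  shows "((\<lambda>s. exp (z s)) has_real_derivative exp (z s) * sin (\<theta> s)) (at s)"
    and "((\<lambda>s. exp (z s) * sin (\<theta> s)) has_real_derivative - c * exp (z s)) (at s)"
proof -
  note th = cgc_solution_angle_ode[OF assms]
  have z: "(z has_real_derivative sin (\<theta> s)) (at s)"
    using assms unfolding cgc_solution_def by blast
  show "((\<lambda>s. exp (z s)) has_real_derivative exp (z s) * sin (\<theta> s)) (at s)"
    using z by (auto intro!: derivative_eq_intros)
  have "exp (z s) * sin (\<theta> s) * sin (\<theta> s) + deriv \<theta> s * cos (\<theta> s) * exp (z s) = - c * exp (z s)"
    unfolding th(2) by (simp add: algebra_simps power2_eq_square)
  then show "((\<lambda>s. exp (z s) * sin (\<theta> s)) has_real_derivative - c * exp (z s)) (at s)"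
    using z th(1) by (auto intro!: derivative_eq_intros simp: algebra_simps)
qed

text \<open>At a zero of \<open>cos \<theta>\<close> the curvature equation reads \<open>c = - 1\<close>. Then \<open>u\<^sup>2 - u'\<^sup>2 = exp (2 z) cos\<^sup>2 \<theta>\<close>
  is a first integral of \<open>u'' = u\<close>, and it is zero.\<close>

lemma cos_angle_zero_everywhere:
  assumes sol: "cgc_solution c I y z \<theta>" and p: "p \<in> I" "cos (\<theta> p) = 0"
  shows "c = - 1" and "\<And>s. s \<in> I \<Longrightarrow> cos (\<theta> s) = 0"
proof -
  have "(sin (\<theta> p))\<^sup>2 = 1" using p(2) by (simp add: sin_squared_eq)
  then show c: "c = - 1" using cgc_solution_angle_ode(2)[OF sol p(1)] p(2) by simp
  define q where "q = (\<lambda>s. (exp (z s))\<^sup>2 - (exp (z s) * sin (\<theta> s))\<^sup>2)"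
  have "(q has_real_derivative 0) (at s)" if "s \<in> I" for s
    using DERIV_diff[OF DERIV_power[OF cgc_solution_exp_ode(1)[OF sol that], of 2]
        DERIV_power[OF cgc_solution_exp_ode(2)[OF sol that], of 2]] c
    by (simp add: q_def algebra_simps)
  moreover have "convex I" using sol is_interval_convex unfolding cgc_solution_def by blast
  ultimately have const: "q s = q p" if "s \<in> I" for s
    using has_field_derivative_zero_constant[of I q] that p(1) has_field_derivative_at_within by metis
  have q: "q s = (exp (z s))\<^sup>2 * (cos (\<theta> s))\<^sup>2" for s
    by (simp add: q_def power_mult_distrib cos_squared_eq algebra_simps)
  show "cos (\<theta> s) = 0" if "s \<in> I" for s
    using const[OF that] p(2) by (simp add: q)
qed


text \<open>If \<open>cos \<theta>\<close> vanishes once, the solution is a vertical line run through with unit speed. It extends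
  to all of the real line, so maximality makes the surface the whole leaf and not a strip in it.\<close>

lemma leaf_of_foliation2:
  assumes max: "maximal_cgc_solution c I y z \<theta>" and p: "p \<in> I" "cos (\<theta> p) = 0"
  shows "invariant_surface I y z \<in> foliation2"
proof -
  have sol: "cgc_solution c I y z \<theta>" using max unfolding maximal_cgc_solution_def by blast
  have c: "c = - 1" and cos0: "\<And>s. s \<in> I \<Longrightarrow> cos (\<theta> s) = 0"
    using cos_angle_zero_everywhere[OF sol p] by auto
  have I: "open I" "is_interval I" using sol unfolding cgc_solution_def by blast+
  have locally_const: "f s = f p" if "\<And>s. s \<in> I \<Longrightarrow> (f has_real_derivative 0) (at s)" "s \<in> I" for f s
    using has_field_derivative_zero_constant[of I f] is_interval_convex[OF I(2)] that p(1)
      has_field_derivative_at_within by metis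
  have sin1: "sin (\<theta> s) \<noteq> 0" if "s \<in> I" for s
    using cos0[OF that] sin_cos_squared_add[of "\<theta> s"] by auto
  have "(\<theta> has_real_derivative 0) (at s)" if "s \<in> I" for s
  proof -
    \<comment> \<open>The curvature equation gives nothing on \<open>\<theta>'\<close> here, since its coefficient \<open>cos \<theta>\<close> is zero;
      differentiating \<open>cos \<theta> = 0\<close> does.\<close>
    note th = cgc_solution_angle_ode(1)[OF sol that]
    have "((\<lambda>s. cos (\<theta> s)) has_real_derivative 0) (at s)"
      using has_field_derivative_transform_within_open[OF DERIV_const[of 0] I(1) that] cos0 by auto
    moreover have "((\<lambda>s. cos (\<theta> s)) has_real_derivative - sin (\<theta> s) * deriv \<theta> s) (at s)"
      using th by (auto intro!: derivative_eq_intros)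
    ultimately have "deriv \<theta> s = 0" using sin1[OF that] DERIV_unique by fastforce
    with th show ?thesis by simp
  qed
  then have theta: "\<theta> s = \<theta> p" if "s \<in> I" for s using locally_const that by blast
  have "(y has_real_derivative 0) (at s)" if "s \<in> I" for s
    using sol cos0 that unfolding cgc_solution_def by fastforce
  then have y: "y s = y p" if "s \<in> I" for s using locally_const that by blast
  define \<sigma> where "\<sigma> = sin (\<theta> p)"
  have "((\<lambda>s. z s - \<sigma> * (s - p)) has_real_derivative 0) (at s)" if "s \<in> I" for s
  proof -
    have "(z has_real_derivative \<sigma>) (at s)"
      using sol that theta[OF that] unfolding cgc_solution_def \<sigma>_def by metis
    then show ?thesis by (auto intro!: derivative_eq_intros)
  qed
  from locally_const[OF this] have z: "z s = z p + \<sigma> * (s - p)" if "s \<in> I" for s using that by fastforce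
  define F where "F = range (\<lambda>(a::real, b::real) s. a * s + b)"
  have F: "(\<lambda>s. a * s + b) \<in> F" for a b :: real unfolding F_def by (rule range_eqI[of _ _ "(a, b)"]) simp
  have smooth: "smooth_on_open UNIV (\<lambda>s. a * s + b)" for a b :: real
  proof (rule smooth_on_open_if_closed_under_deriv[OF open_UNIV F])
    fix f assume "f \<in> F"
    then obtain a b where f: "f = (\<lambda>s. a * s + b)" by (auto simp: F_def)
    show "\<exists>g\<in>F. \<forall>s\<in>UNIV. (f has_real_derivative g s) (at s)"
      by (rule bexI[OF _ F[of 0 a]]) (auto simp: f intro!: derivative_eq_intros)
  qed
  have line: "(\<lambda>s. z p + \<sigma> * (s - p)) = (\<lambda>s. \<sigma> * s + (z p - \<sigma> * p))" by (auto simp: algebra_simps)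
  have "gauss_curvature (induced_metric (surface_param (\<lambda>s. y p) (\<lambda>s. z p + \<sigma> * (s - p)))) (vector [s, t]) = c" for s t
  proof -
    have "gauss_curvature (induced_metric (surface_param (\<lambda>s. y p) (\<lambda>s. z p + \<sigma> * (s - p)))) (vector [s, t])
      = - 0 * cos (\<theta> p) - (sin (\<theta> p))\<^sup>2"
      by (rule gauss_curvature_invariant_surface[of UNIV])
        (auto simp: p(2) \<sigma>_def intro!: derivative_eq_intros)
    then show ?thesis using p(2) c by (simp add: sin_squared_eq)
  qed
  moreover have "((\<lambda>s. z p + \<sigma> * (s - p)) has_real_derivative sin (\<theta> p)) (at s)" for s
    by (auto simp: \<sigma>_def intro!: derivative_eq_intros)
  moreover have "smooth_on_open UNIV (\<lambda>s. y p)" "smooth_on_open UNIV (\<lambda>s. \<theta> p)"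
    "smooth_on_open UNIV (\<lambda>s. z p + \<sigma> * (s - p))"
    using smooth[of 0 "y p"] smooth[of 0 "\<theta> p"] smooth[of \<sigma> "z p - \<sigma> * p"]
    by (simp_all add: line)
  ultimately have "cgc_solution c UNIV (\<lambda>s. y p) (\<lambda>s. z p + \<sigma> * (s - p)) (\<lambda>s. \<theta> p)"
    unfolding cgc_solution_def by (simp add: p(2))
  moreover have "y p = y s \<and> z p + \<sigma> * (s - p) = z s \<and> \<theta> p = \<theta> s" if "s \<in> I" for s
    using y[OF that] z[OF that] theta[OF that] by linarith
  ultimately have UNIV: "I = UNIV"
    using max unfolding maximal_cgc_solution_def by blast
  have "invariant_surface I y z = {q. q$2 = y p}"
  proof (intro equalityI subsetI)
    fix q assume "q \<in> invariant_surface I y z"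
    then obtain t where "t$1 \<in> I" "q = surface_param y z t" by (auto simp: invariant_surface_def)
    then have "q$2 = y p" using y[of "t$1"] by (simp add: surface_param_def)
    then show "q \<in> {q. q$2 = y p}" by simp
  next
    fix q :: "real^3" assume q: "q \<in> {q. q$2 = y p}"
    define s where "s = p + (q$3 - z p) / \<sigma>"
    have "z s = q$3" using z[of s] sin1[OF p(1)] UNIV by (simp add: s_def \<sigma>_def)
    moreover have "y s = q$2" using q y[of s] UNIV by simp
    ultimately have "q = surface_param y z (vector [s, q$1])"
      by (simp add: surface_param_def vec_eq_iff forall_3)
    then show "q \<in> invariant_surface I y z"
      by (auto simp: invariant_surface_def UNIV)
  qed
  then show ?thesis by (auto simp: foliation2_def)
qed

section \<open>Surfaces determined by a profile\<close>

text \<open>A profile is a global solution \<open>w\<close> of the linear equation with an interval \<open>J\<close> that is a connected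
  component of the set where \<open>\<bar>w'\<bar> < w\<close>. That inequality is what \<open>u = exp z\<close>, \<open>u' = u sin \<theta>\<close> satisfies as long
  as \<open>cos \<theta> \<noteq> 0\<close>; the condition on the frontier says that it breaks down at the ends of \<open>J\<close>, so that no
  solution with \<open>cos \<theta> \<noteq> 0\<close> can be continued across them.\<close>

locale profile =
  fixes c :: real and w w' :: "real \<Rightarrow> real" and J :: "real set"
  assumes w: "(w has_real_derivative w' s) (at s)"
    and w': "(w' has_real_derivative - c * w s) (at s)"
    and J: "open J" "is_interval J"
    and admissible: "s \<in> J \<Longrightarrow> \<bar>w' s\<bar> < w s"
    and frontier: "s \<in> frontier J \<Longrightarrow> w s \<le> \<bar>w' s\<bar>"
begin

lemma w_pos: "s \<in> J \<Longrightarrow> w s > 0"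
  using admissible[of s] by linarith

text \<open>The real square root is continuous also for negative arguments, so the antiderivative exists on
  the whole line and is in particular continuous up to the ends of \<open>J\<close>.\<close>

lemma antiderivative_exists:
  "\<exists>Y. \<forall>s. (Y has_real_derivative sqrt ((w s)\<^sup>2 - (w' s)\<^sup>2)) (at s)"
proof -
  have "isCont (\<lambda>s. sqrt ((w s)\<^sup>2 - (w' s)\<^sup>2)) s" for s
    using DERIV_isCont[OF w] DERIV_isCont[OF w'] by (intro continuous_intros)
  then show ?thesis
    using einterval_antiderivative[of "-\<infinity>" "\<infinity>" "\<lambda>s. sqrt ((w s)\<^sup>2 - (w' s)\<^sup>2)"]
    by (auto simp: has_real_derivative_iff_has_vector_derivative)
qed

lemma speed_pos: "s \<in> J \<Longrightarrow> 0 < sqrt ((w s)\<^sup>2 - (w' s)\<^sup>2)"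
  using admissible[of s] power2_strict_mono[of "w' s" "w s"] by simp

text \<open>It suffices to compare a maximal solution with a profile at one point. Scale the profile so
  that its value at \<open>s1\<close> is \<open>exp (z p)\<close>; the last assumption then matches the first derivatives.
  By uniqueness \<open>exp z\<close> is the scaled profile \<open>v\<close> on all of \<open>I\<close>, so \<open>I\<close> lies in the affine image \<open>K\<close> of
  \<open>J\<close>. Conversely \<open>v\<close> gives a solution on \<open>K\<close>, with \<open>z = ln v\<close> and \<open>sin \<theta> = v' / v\<close>,
  that extends the given one, so \<open>I = K\<close> by maximality. The sign \<open>\<tau>\<close> combines the orientation
  \<open>\<epsilon>\<close> with the sign of \<open>cos \<theta>\<close>.\<close>

theorem maximal_solution_from_profile:
  assumes max: "maximal_cgc_solution c I y z \<theta>"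
    and p: "p \<in> I" and cos: "\<And>s. s \<in> I \<Longrightarrow> cos (\<theta> s) \<noteq> 0"
    and Y: "\<And>s. s \<in> J \<Longrightarrow> (Y has_real_derivative sqrt ((w s)\<^sup>2 - (w' s)\<^sup>2)) (at s)"
    and \<epsilon>: "\<epsilon> \<in> {1, -1}" and s1: "s1 \<in> J" "\<epsilon> * w' s1 = sin (\<theta> p) * w s1"
  obtains s0 M \<tau> b where "M > 0" "\<tau> \<in> {1, -1}" "I = {s. \<epsilon> * (s - s0) \<in> J}"
    "\<And>s. s \<in> I \<Longrightarrow> z s = ln M + ln (w (\<epsilon> * (s - s0)))"
    "\<And>s. s \<in> I \<Longrightarrow> y s = b + \<tau> * M * Y (\<epsilon> * (s - s0))"
proof -
  have sol: "cgc_solution c I y z \<theta>" using max unfolding maximal_cgc_solution_def by blast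
  have I: "open I" "is_interval I" using sol unfolding cgc_solution_def by blast+
  have \<epsilon>2: "\<epsilon> * \<epsilon> = 1" and abs_\<epsilon>: "\<bar>\<epsilon>\<bar> = 1" using \<epsilon> by auto
  define s0 where "s0 = p - \<epsilon> * s1"
  define M where "M = exp (z p) / w s1"
  define \<phi> where "\<phi> = (\<lambda>s. \<epsilon> * (s - s0))"
  define v where "v = (\<lambda>s. M * w (\<phi> s))"
  define v' where "v' = (\<lambda>s. \<epsilon> * M * w' (\<phi> s))"
  define K where "K = {s. \<phi> s \<in> J}"
  have M: "M > 0" using w_pos[OF s1(1)] by (simp add: M_def)
  have \<phi>p: "\<phi> p = s1" using \<epsilon>2 by (simp add: \<phi>_def s0_def algebra_simps flip: mult.assoc)
  have d\<phi>: "(\<phi> has_real_derivative \<epsilon>) (at s)" for s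
    unfolding \<phi>_def by (auto intro!: derivative_eq_intros)
  have dv: "(v has_real_derivative v' s) (at s)" for s
    using DERIV_cmult[OF DERIV_chain2[OF w d\<phi>], of M] by (simp add: v_def v'_def mult_ac)
  have dv': "(v' has_real_derivative - c * v s) (at s)" for s
  proof -
    have "(v' has_real_derivative \<epsilon> * M * (- c * w (\<phi> s) * \<epsilon>)) (at s)"
      unfolding v'_def by (rule DERIV_cmult[OF DERIV_chain2[OF w' d\<phi>]])
    moreover have "\<epsilon> * M * (- c * w (\<phi> s) * \<epsilon>) = - c * v s" using \<epsilon> by (auto simp: v_def)
    ultimately show ?thesis by (simp only:)
  qed

  have init: "exp (z p) = v p" "exp (z p) * sin (\<theta> p) = v' p"
    using s1(2) w_pos[OF s1(1)] by (simp_all add: v_def v'_def \<phi>p M_def field_simps)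
  have ez: "exp (z s) = v s" "exp (z s) * sin (\<theta> s) = v' s" if s: "s \<in> I" for s
  proof -
    let ?d = "\<lambda>s. exp (z s) - v s" and ?d' = "\<lambda>s. exp (z s) * sin (\<theta> s) - v' s"
    have "(?d has_real_derivative ?d' s) (at s)" "(?d' has_real_derivative - c * ?d s) (at s)"
      if "s \<in> I" for s
      using DERIV_diff[OF cgc_solution_exp_ode(1)[OF sol that] dv]
        DERIV_diff[OF cgc_solution_exp_ode(2)[OF sol that] dv'] by (simp_all add: algebra_simps)
    from linear_ode_zero[of I p s ?d ?d' c, OF I(2) p s this] init
    show "exp (z s) = v s" "exp (z s) * sin (\<theta> s) = v' s" by auto
  qed
  have sin_lt: "\<bar>sin (\<theta> s)\<bar> < 1" if "s \<in> I" for s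
    using abs_sin_less_1[OF cos[OF that]] .

  \<comment> \<open>A connected set that meets \<open>J\<close> and leaves it crosses the frontier, where \<open>cos \<theta>\<close> would vanish.\<close>
  have "\<phi> ` I \<subseteq> J"
  proof (rule ccontr)
    assume "\<not> \<phi> ` I \<subseteq> J"
    moreover have "connected (\<phi> ` I)"
      using is_interval_connected[OF I(2)] unfolding \<phi>_def
      by (intro connected_continuous_image continuous_intros)
    moreover have "\<phi> ` I \<inter> J \<noteq> {}" using \<phi>p s1(1) p by blast
    ultimately have "\<phi> ` I \<inter> frontier J \<noteq> {}" by (intro connected_Int_frontier) auto
    then obtain s where s: "s \<in> I" "w (\<phi> s) \<le> \<bar>w' (\<phi> s)\<bar>" using frontier by blast
    have "exp (z s) * \<bar>sin (\<theta> s)\<bar> < exp (z s)" using sin_lt[OF s(1)] by simp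
    moreover have "\<bar>v' s\<bar> = exp (z s) * \<bar>sin (\<theta> s)\<bar>" using ez(2)[OF s(1)] by (metis abs_mult abs_exp_cancel)
    ultimately have "\<bar>v' s\<bar> < v s" using ez(1)[OF s(1)] by simp
    then show False using s(2) M abs_\<epsilon> by (simp add: v_def v'_def abs_mult)
  qed
  then have IK: "I \<subseteq> K" by (auto simp: K_def)
  have "continuous_on UNIV \<phi>" unfolding \<phi>_def by (intro continuous_intros)
  from open_vimage[OF J(1) this] have openK: "open K" by (simp add: K_def vimage_def)
  have intK: "is_interval K"
    unfolding is_interval_1
  proof (intro ballI allI impI)
    fix a b x assume *: "a \<in> K" "b \<in> K" "a \<le> x \<and> x \<le> b"
    from \<epsilon> consider "\<phi> a \<le> \<phi> x" "\<phi> x \<le> \<phi> b" | "\<phi> b \<le> \<phi> x" "\<phi> x \<le> \<phi> a"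
      using *(3) by (auto simp: \<phi>_def)
    then show "x \<in> K"
      using * mem_is_interval_1_I[OF J(2)] unfolding K_def by cases blast+
  qed

  \<comment> \<open>The branch of the angle: \<open>\<theta>\<close> stays within \<open>pi / 2\<close> of one multiple \<open>\<theta>0\<close> of \<open>pi\<close>, which lets
    \<open>\<theta>\<close> be recovered from its sine.\<close>
  have "\<exists>\<theta>0. sin \<theta>0 = 0 \<and> \<bar>\<theta> p - \<theta>0\<bar> < pi / 2"
  proof -
    define n where "n = round (\<theta> p / pi)"
    have "\<bar>of_int n - \<theta> p / pi\<bar> * pi \<le> 1 / 2 * pi"
      unfolding n_def by (intro mult_right_mono of_int_round_abs_le) auto
    also have "\<bar>of_int n - \<theta> p / pi\<bar> * pi = \<bar>(of_int n - \<theta> p / pi) * pi\<bar>" by (simp add: abs_mult)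
    also have "(of_int n - \<theta> p / pi) * pi = pi * of_int n - \<theta> p" by (simp add: field_simps)
    finally have le: "\<bar>\<theta> p - pi * of_int n\<bar> \<le> pi / 2" by (simp add: abs_minus_commute)
    have "\<bar>\<theta> p - pi * of_int n\<bar> \<noteq> pi / 2"
    proof
      assume "\<bar>\<theta> p - pi * of_int n\<bar> = pi / 2"
      then have "\<theta> p = pi * of_int n + pi / 2 \<or> \<theta> p = pi * of_int n - pi / 2" by linarith
      then have "cos (\<theta> p) = 0" by (auto simp: cos_add cos_diff)
      then show False using cos[OF p] by simp
    qed
    with le show ?thesis by (intro exI[of _ "pi * of_int n"]) auto
  qed
  then obtain \<theta>0 where \<theta>0: "sin \<theta>0 = 0" "\<bar>\<theta> p - \<theta>0\<bar> < pi / 2" by blast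
  define \<sigma> where "\<sigma> = cos \<theta>0"
  have \<sigma>2: "\<sigma> * \<sigma> = 1" using sin_cos_squared_add[of \<theta>0] \<theta>0(1) by (simp add: \<sigma>_def power2_eq_square)
  then have \<sigma>: "\<sigma> \<in> {1, -1}" using square_eq_1_iff by blast
  have \<theta>_near: "\<bar>\<theta> s - \<theta>0\<bar> < pi / 2" if s: "s \<in> I" for s
  proof (rule ccontr)
    assume far: "\<not> \<bar>\<theta> s - \<theta>0\<bar> < pi / 2"
    have "continuous_on I \<theta>"
      using cgc_solution_angle_ode(1)[OF sol] DERIV_isCont continuous_at_imp_continuous_on by blast
    then have conn: "connected (\<theta> ` I)"
      using is_interval_connected[OF I(2)] connected_continuous_image by blast
    have "\<theta>0 + pi / 2 \<in> \<theta> ` I \<or> \<theta>0 - pi / 2 \<in> \<theta> ` I"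
      using far \<theta>0(2) connectedD_interval[OF conn, of "\<theta> p" "\<theta> s" "\<theta>0 + pi / 2"]
        connectedD_interval[OF conn, of "\<theta> s" "\<theta> p" "\<theta>0 - pi / 2"] p s
      by (smt (verit) image_eqI)
    then obtain r where "r \<in> I" "\<theta> r = \<theta>0 + pi / 2 \<or> \<theta> r = \<theta>0 - pi / 2" by force
    moreover then have "cos (\<theta> r) = 0" using \<theta>0(1) by (auto simp: cos_add cos_diff)
    ultimately show False using cos by blast
  qed

  define \<rho> where "\<rho> = (\<lambda>s. v' s / v s)"
  define \<Theta> where "\<Theta> = (\<lambda>s. \<theta>0 + arcsin (\<sigma> * \<rho> s))"
  define Z where "Z = (\<lambda>s. ln (v s))"
  define \<tau> where "\<tau> = \<sigma> * \<epsilon>"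
  define H where "H = (\<lambda>s. y p + \<tau> * M * (Y (\<phi> s) - Y s1))"
  have vpos: "v s > 0" if "s \<in> K" for s
    using that M w_pos by (simp add: K_def v_def)
  have \<rho>_lt: "\<bar>\<rho> s\<bar> < 1" if "s \<in> K" for s
    using that M admissible[of "\<phi> s"] w_pos[of "\<phi> s"] abs_\<epsilon>
    by (simp add: K_def \<rho>_def v_def v'_def abs_mult abs_divide)
  have \<sigma>\<rho>_lt: "- 1 < \<sigma> * \<rho> s" "\<sigma> * \<rho> s < 1" if "s \<in> K" for s
    using \<rho>_lt[OF that] \<sigma> by auto
  have \<sigma>\<rho>2: "(\<sigma> * \<rho> s)\<^sup>2 = (\<rho> s)\<^sup>2" for s using \<sigma> by auto
  have root_pos: "0 < sqrt (1 - (\<rho> s)\<^sup>2)" if "s \<in> K" for s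
    using \<rho>_lt[OF that] by (simp add: abs_square_less_1)
  have sin\<Theta>: "sin (\<Theta> s) = \<rho> s" if "s \<in> K" for s
    using \<sigma>\<rho>_lt[OF that] \<theta>0(1) \<sigma> by (auto simp: \<Theta>_def sin_add simp flip: \<sigma>_def)
  have cos\<Theta>: "cos (\<Theta> s) = \<sigma> * sqrt (1 - (\<rho> s)\<^sup>2)" if "s \<in> K" for s
    using \<sigma>\<rho>_lt[OF that] \<theta>0(1) cos_arcsin[of "\<sigma> * \<rho> s"] \<sigma>\<rho>2[of s]
    by (simp add: \<Theta>_def cos_add flip: \<sigma>_def)
  have d\<rho>: "(\<rho> has_real_derivative - c - (\<rho> s)\<^sup>2) (at s)" if "s \<in> K" for s
  proof -
    have "(\<rho> has_real_derivative ((- c * v s) * v s - v' s * v' s) / (v s * v s)) (at s)"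
      unfolding \<rho>_def using vpos[OF that] by (intro DERIV_divide dv dv') auto
    moreover have "((- c * v s) * v s - v' s * v' s) / (v s * v s) = - c - (\<rho> s)\<^sup>2"
      using vpos[OF that] by (simp add: \<rho>_def field_simps power2_eq_square)
    ultimately show ?thesis by simp
  qed
  have d\<Theta>: "(\<Theta> has_real_derivative (- c - (sin (\<Theta> s))\<^sup>2) / cos (\<Theta> s)) (at s)" if "s \<in> K" for s
  proof -
    have "((\<lambda>s. \<sigma> * \<rho> s) has_real_derivative \<sigma> * (- c - (\<rho> s)\<^sup>2)) (at s)"
      by (rule DERIV_cmult[OF d\<rho>[OF that]])
    from DERIV_chain2[OF DERIV_arcsin[OF \<sigma>\<rho>_lt[OF that]] this]
    have "(\<Theta> has_real_derivative inverse (sqrt (1 - (\<rho> s)\<^sup>2)) * (\<sigma> * (- c - (\<rho> s)\<^sup>2))) (at s)"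
      using DERIV_add[OF DERIV_const[of \<theta>0]] unfolding \<Theta>_def \<sigma>\<rho>2 by fastforce
    moreover have "inverse (sqrt (1 - (\<rho> s)\<^sup>2)) * (\<sigma> * (- c - (\<rho> s)\<^sup>2))
        = (- c - (sin (\<Theta> s))\<^sup>2) / cos (\<Theta> s)"
      unfolding sin\<Theta>[OF that] cos\<Theta>[OF that] using \<sigma> by (auto simp: divide_simps)
    ultimately show ?thesis by simp
  qed
  have dZ: "(Z has_real_derivative sin (\<Theta> s)) (at s)" if "s \<in> K" for s
    unfolding Z_def using DERIV_chain2[OF DERIV_ln_divide[OF vpos[OF that]] dv] 
    by (simp add: sin\<Theta>[OF that] \<rho>_def)
  have dH: "(H has_real_derivative exp (Z s) * cos (\<Theta> s)) (at s)" if "s \<in> K" for s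
  proof -
    have "(H has_real_derivative 0 + \<tau> * M * (sqrt ((w (\<phi> s))\<^sup>2 - (w' (\<phi> s))\<^sup>2) * \<epsilon> - 0)) (at s)"
      unfolding H_def using that
      by (intro DERIV_add DERIV_cmult DERIV_diff DERIV_const DERIV_chain2[OF Y d\<phi>]) (auto simp: K_def)
    moreover have "exp (Z s) * cos (\<Theta> s) = \<sigma> * M * sqrt ((w (\<phi> s))\<^sup>2 - (w' (\<phi> s))\<^sup>2)"
    proof -
      have "v s * sqrt (1 - (\<rho> s)\<^sup>2) = sqrt ((v s)\<^sup>2 * (1 - (\<rho> s)\<^sup>2))"
        using vpos[OF that] by (simp add: real_sqrt_mult)
      also have "(v s)\<^sup>2 * (1 - (\<rho> s)\<^sup>2) = (v s)\<^sup>2 - (v' s)\<^sup>2"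
        using vpos[OF that] by (simp add: \<rho>_def field_simps)
      also have "\<dots> = M\<^sup>2 * ((w (\<phi> s))\<^sup>2 - (w' (\<phi> s))\<^sup>2)"
        using \<epsilon> by (auto simp: v_def v'_def algebra_simps)
      also have "sqrt \<dots> = M * sqrt ((w (\<phi> s))\<^sup>2 - (w' (\<phi> s))\<^sup>2)"
        using M by (simp add: real_sqrt_mult)
      finally show ?thesis using vpos[OF that] by (simp add: Z_def cos\<Theta>[OF that])
    qed
    ultimately show ?thesis using \<epsilon> by (auto simp: \<tau>_def)
  qed
  have solK: "cgc_solution c K H Z \<Theta>"
  proof (rule cgc_solutionI[OF openK intK _ dH dZ d\<Theta>])
    show "K \<noteq> {}" using IK p by blast
    show "cos (\<Theta> s) \<noteq> 0" if "s \<in> K" for s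
      using root_pos[OF that] \<sigma> by (auto simp: cos\<Theta>[OF that])
  qed

  have zZ: "Z s = z s" if "s \<in> I" for s
    using ez(1)[OF that] by (simp add: Z_def flip: ez(1)[OF that])
  have sin_eq: "sin (\<theta> s) = \<rho> s" if "s \<in> I" for s
    using ez[OF that] by (simp add: \<rho>_def nonzero_eq_divide_eq mult.commute flip: ez(1)[OF that])
  have \<theta>\<Theta>: "\<Theta> s = \<theta> s" if s: "s \<in> I" for s
  proof -
    have "sin (\<theta> s - \<theta>0) = \<sigma> * sin (\<theta> s)" using \<theta>0(1) by (simp add: sin_diff \<sigma>_def)
    then have "arcsin (\<sigma> * \<rho> s) = arcsin (sin (\<theta> s - \<theta>0))" using sin_eq[OF s] by simp
    also have "\<dots> = \<theta> s - \<theta>0" using \<theta>_near[OF s] by (intro arcsin_sin; linarith)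
    finally show ?thesis by (simp add: \<Theta>_def)
  qed
  have yH: "H s = y s" if s: "s \<in> I" for s
  proof -
    have "((\<lambda>s. H s - y s) has_real_derivative 0) (at s)" if "s \<in> I" for s
    proof -
      have "(y has_real_derivative exp (z s) * cos (\<theta> s)) (at s)"
        using sol that unfolding cgc_solution_def by blast
      from DERIV_diff[OF dH this] show ?thesis using that IK zZ \<theta>\<Theta> by auto
    qed
    then have "H s - y s = H p - y p"
      using has_field_derivative_zero_constant[of I "\<lambda>s. H s - y s"] is_interval_convex[OF I(2)] s p
        has_field_derivative_at_within by metis
    then show ?thesis by (simp add: H_def \<phi>p)
  qed
  have "K = I"
    using max solK IK zZ \<theta>\<Theta> yH unfolding maximal_cgc_solution_def by blast
  moreover have "\<tau> \<in> {1, -1}" using \<sigma> \<epsilon> by (auto simp: \<tau>_def)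
  ultimately show thesis
  proof (intro that[of M \<tau> s0 "y p - \<tau> * M * Y s1"])
    fix s assume s: "s \<in> I"
    then have "w (\<phi> s) > 0" using IK w_pos by (auto simp: K_def)
    then show "z s = ln M + ln (w (\<epsilon> * (s - s0)))"
      using zZ[OF s] M by (simp add: Z_def v_def ln_mult \<phi>_def)
    show "y s = y p - \<tau> * M * Y s1 + \<tau> * M * Y (\<epsilon> * (s - s0))"
      using yH[OF s] by (simp add: H_def \<phi>_def algebra_simps)
  qed (use M in \<open>auto simp: K_def \<phi>_def\<close>)
qed

text \<open>The isometries absorb the integration constants: the scale \<open>M\<close> of the profile is removed by a
  dilation, the sign \<open>\<tau>\<close> by the reflection, and the additive constant \<open>b\<close> by a translation.\<close>

corollary profile_up_to_integration_constants:
  assumes "maximal_cgc_solution c I y z \<theta>"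
    and "p \<in> I" and "\<And>s. s \<in> I \<Longrightarrow> cos (\<theta> s) \<noteq> 0"
    and "\<And>s. s \<in> J \<Longrightarrow> (Y has_real_derivative sqrt ((w s)\<^sup>2 - (w' s)\<^sup>2)) (at s)"
    and \<epsilon>: "\<epsilon> \<in> {1, -1}" and "s1 \<in> J" "\<epsilon> * w' s1 = sin (\<theta> p) * w s1"
  shows "up_to_integration_constants I (gen_curve y z) J (\<lambda>s. vector [0, Y s, ln (w s)])"
proof -
  obtain s0 M \<tau> b where M: "M > 0" and \<tau>: "\<tau> \<in> {1, -1}" and I: "I = {s. \<epsilon> * (s - s0) \<in> J}"
    and z: "\<And>s. s \<in> I \<Longrightarrow> z s = ln M + ln (w (\<epsilon> * (s - s0)))"
    and y: "\<And>s. s \<in> I \<Longrightarrow> y s = b + \<tau> * M * Y (\<epsilon> * (s - s0))"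
    using maximal_solution_from_profile[OF assms] by metis
  define D :: "real^3 \<Rightarrow> real^3"
    where "D = (\<lambda>p. vector [exp (ln M) * p$1, exp (- ln M) * p$2, p$3 - ln M]) \<circ> id"
  define R :: "real^3 \<Rightarrow> real^3"
    where "R = (if \<tau> = 1 then D else (\<lambda>p. vector [p$1, - p$2, p$3]) \<circ> D)"
  define \<Phi> :: "real^3 \<Rightarrow> real^3"
    where "\<Phi> = (\<lambda>p. vector [p$1, p$2 + (- \<tau> * b / M), p$3]) \<circ> R"
  have "D \<in> integration_isometries" unfolding D_def
    by (intro integration_isometries.intros)
  then have "R \<in> integration_isometries" unfolding R_def
    by (auto intro: integration_isometries.reflect)
  then have \<Phi>: "\<Phi> \<in> integration_isometries" unfolding \<Phi>_def
    by (rule integration_isometries.translate)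
  have inv: "\<epsilon> * (\<epsilon> * s + s0 - s0) = s" for s using \<epsilon> by auto
  have "vector [0, Y s, ln (w s)] = \<Phi> (gen_curve y z (\<epsilon> * s + s0))" if "s \<in> J" for s
  proof -
    have mem: "\<epsilon> * s + s0 \<in> I" unfolding I mem_Collect_eq inv using that .
    show ?thesis
      using M \<tau> y[OF mem] z[OF mem] unfolding inv
      by (auto simp: \<Phi>_def R_def D_def gen_curve_def vec_eq_iff forall_3 exp_minus field_simps)
  qed
  moreover have "J = {s. \<epsilon> * s + s0 \<in> I}" unfolding I mem_Collect_eq inv by simp
  ultimately show ?thesis
    unfolding up_to_integration_constants_def using \<epsilon> \<Phi> by blast
qed

end

section \<open>Graphs of unimodal functions\<close>

lemma is_graph_inverse:
  assumes "inj_on Y J" "\<And>s. s \<in> J \<Longrightarrow> \<beta> s = vector [0, Y s, h s]"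
  shows "is_graph J \<beta> (\<lambda>v. h (the_inv_into J Y v)) (Y ` J)"
proof -
  have "\<beta> ` J = (\<lambda>v. vector [0, v, h (the_inv_into J Y v)]) ` Y ` J"
    unfolding image_image by (rule image_cong) (simp_all add: assms the_inv_into_f_f)
  then show ?thesis by (auto simp: is_graph_def)
qed

text \<open>Openness of \<open>D\<close> matters: every point other than \<open>v0\<close> has neighbours in \<open>D\<close> on both sides, within the
  same monotone branch, and these exclude an extremum.\<close>

lemma single_minimum_unimodal:
  assumes D: "open D" "v0 \<in> D"
    and dec: "\<And>u v. u \<in> D \<Longrightarrow> v \<in> D \<Longrightarrow> u < v \<Longrightarrow> v \<le> v0 \<Longrightarrow> f v < f u"
    and inc: "\<And>u v. u \<in> D \<Longrightarrow> v \<in> D \<Longrightarrow> v0 \<le> u \<Longrightarrow> u < v \<Longrightarrow> f u < f v"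
  shows "single_minimum f D"
  unfolding single_minimum_def
proof (intro bexI[OF _ D(2)] conjI ballI allI impI)
  fix v assume "v \<in> D"
  then show "f v0 \<le> f v" using dec[of v v0] inc[of v0 v] D(2) by (cases v v0 rule: linorder_cases) auto
next
  fix v assume ext: "local_extremum_at f D v"
  then have v: "v \<in> D" unfolding local_extremum_at_def local_min_at_def by auto
  have near: "\<forall>\<^sub>F u in nhds v. u \<in> D" using D(1) v by (rule eventually_nhds_in_open)
  show "v = v0"
  proof (rule ccontr)
    assume ne: "v \<noteq> v0"
    have sides: "\<exists>u. l < u \<and> u < v \<and> u \<in> D \<and> P u" "\<exists>u. v < u \<and> u < r \<and> u \<in> D \<and> P u"
      if "\<forall>\<^sub>F u in at v within D. P u" "l < v" "v < r" for P l r
    proof -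
      have "\<forall>\<^sub>F u in at v. P u" using that(1) at_within_open[OF v D(1)] by simp
      moreover have "\<forall>\<^sub>F u in at v. u \<in> D"
        using near unfolding eventually_at_filter by (rule eventually_mono) simp
      ultimately have "\<forall>\<^sub>F u in at v. u \<in> D \<and> P u" by (simp add: eventually_conj)
      then obtain d where d: "d > 0" "\<And>u. u \<noteq> v \<Longrightarrow> \<bar>u - v\<bar> < d \<Longrightarrow> u \<in> D \<and> P u"
        unfolding eventually_at by (auto simp: dist_real_def)
      have "max l (v - d) < v" "v < min r (v + d)" using that d(1) by auto
      then obtain u u' where u: "max l (v - d) < u" "u < v" "v < u'" "u' < min r (v + d)"
        using dense by metis
      then show "\<exists>u. l < u \<and> u < v \<and> u \<in> D \<and> P u" using d(2)[of u] by (intro exI[of _ u]) auto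
      from u show "\<exists>u. v < u \<and> u < r \<and> u \<in> D \<and> P u" using d(2)[of u'] by (intro exI[of _ u']) auto
    qed
    \<comment> \<open>Neighbours of \<open>v\<close> are taken between \<open>l\<close> and \<open>r\<close>, which do not pass beyond \<open>v0\<close>.\<close>
    define l where "l = (if v0 < v then v0 else v - 1)"
    define r where "r = (if v < v0 then v0 else v + 1)"
    have lr: "l < v" "v < r" using ne by (auto simp: l_def r_def)
    from ext consider "\<forall>\<^sub>F u in at v within D. f v \<le> f u" | "\<forall>\<^sub>F u in at v within D. - f v \<le> - f u"
      unfolding local_extremum_at_def local_min_at_def by auto
    then show False
    proof cases
      case 1
      obtain a b where "l < a" "a < v" "a \<in> D" "f v \<le> f a" "v < b" "b < r" "b \<in> D" "f v \<le> f b"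
        using sides[OF 1 lr] by blast
      then show False using inc[of a v] dec[of v b] v ne
        by (cases v v0 rule: linorder_cases) (auto simp: l_def r_def)
    next
      case 2
      obtain a b where "l < a" "a < v" "a \<in> D" "f a \<le> f v" "v < b" "b < r" "b \<in> D" "f b \<le> f v"
        using sides[OF 2 lr] by (metis neg_le_iff_le)
      then show False using dec[of a v] inc[of v b] v ne
        by (cases v v0 rule: linorder_cases) (auto simp: l_def r_def)
    qed
  qed
qed

lemma graph_single_minimum:
  fixes Y h :: "real \<Rightarrow> real"
  assumes Y: "strict_mono_on J Y" and op: "open (Y ` J)" and s0: "s0 \<in> J"
    and dec: "\<And>s t. s \<in> J \<Longrightarrow> t \<in> J \<Longrightarrow> s < t \<Longrightarrow> t \<le> s0 \<Longrightarrow> h t < h s"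
    and inc: "\<And>s t. s \<in> J \<Longrightarrow> t \<in> J \<Longrightarrow> s0 \<le> s \<Longrightarrow> s < t \<Longrightarrow> h s < h t"
  shows "single_minimum (\<lambda>v. h (the_inv_into J Y v)) (Y ` J)"
proof (rule single_minimum_unimodal[OF op])
  have inj: "inj_on Y J" using Y by (rule strict_mono_on_imp_inj_on)
  note inv[simp] = the_inv_into_f_f[OF inj]
  have less: "Y s < Y t \<longleftrightarrow> s < t" "Y s \<le> Y t \<longleftrightarrow> s \<le> t" if "s \<in> J" "t \<in> J" for s t
    using that Y by (auto simp: strict_mono_on_less strict_mono_on_less_eq)
  show "Y s0 \<in> Y ` J" using s0 by blast
  show "h (the_inv_into J Y v) < h (the_inv_into J Y u)"
    if "u \<in> Y ` J" "v \<in> Y ` J" "u < v" "v \<le> Y s0" for u v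
    using that s0 by (auto simp: less intro!: dec)
  show "h (the_inv_into J Y u) < h (the_inv_into J Y v)"
    if "u \<in> Y ` J" "v \<in> Y ` J" "Y s0 \<le> u" "u < v" for u v
    using that s0 by (auto simp: less intro!: inc)
qed

section \<open>Profiles on a bounded interval\<close>

text \<open>A curve point whose first coordinate \<open>Y s\<close> approaches an end of the range has its parameter \<open>s\<close>
  approaching the corresponding end of the parameter interval.\<close>

lemma endpoint_filter_le:
  fixes Y :: "real \<Rightarrow> real"
  assumes Y: "strict_mono_on {a..b} Y" and ab: "a < b"
  shows "inf (filtercomap Y (at (Y a))) (principal {a<..<b}) \<le> at a"
    and "inf (filtercomap Y (at (Y b))) (principal {a<..<b}) \<le> at b"
proof -
  have less: "Y s < Y t \<longleftrightarrow> s < t" if "s \<in> {a..b}" "t \<in> {a..b}" for s t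
    using that Y by (simp add: strict_mono_on_less)
  show "inf (filtercomap Y (at (Y a))) (principal {a<..<b}) \<le> at a"
  proof (rule filter_leI)
    fix P :: "real \<Rightarrow> bool" assume "eventually P (at a)"
    then obtain d where d: "d > 0" "\<And>x. x \<noteq> a \<Longrightarrow> dist x a < d \<Longrightarrow> P x"
      unfolding eventually_at by blast
    obtain t where t: "a < t" "t < min b (a + d)" using dense[of a "min b (a + d)"] ab d(1) by auto
    have "Y a < Y t" using t by (simp add: less)
    then have "\<forall>\<^sub>F v in nhds (Y a). v < Y t" by (intro eventually_nhds_in_open[of "{..<Y t}", simplified])
    then have "\<forall>\<^sub>F v in at (Y a). v < Y t" unfolding eventually_at_filter by (rule eventually_mono) simp
    then show "eventually P (inf (filtercomap Y (at (Y a))) (principal {a<..<b}))"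
      unfolding eventually_inf_principal eventually_filtercomap
      by (rule exI[of _ "\<lambda>v. v < Y t", OF conjI]) (use t less d(2) in \<open>auto simp: dist_real_def\<close>)
  qed
  show "inf (filtercomap Y (at (Y b))) (principal {a<..<b}) \<le> at b"
  proof (rule filter_leI)
    fix P :: "real \<Rightarrow> bool" assume "eventually P (at b)"
    then obtain d where d: "d > 0" "\<And>x. x \<noteq> b \<Longrightarrow> dist x b < d \<Longrightarrow> P x"
      unfolding eventually_at by blast
    obtain t where t: "t < b" "max a (b - d) < t" using dense[of "max a (b - d)" b] ab d(1) by auto
    have "Y t < Y b" using t by (simp add: less)
    then have "\<forall>\<^sub>F v in nhds (Y b). Y t < v" by (intro eventually_nhds_in_open[of "{Y t<..}", simplified])
    then have "\<forall>\<^sub>F v in at (Y b). Y t < v" unfolding eventually_at_filter by (rule eventually_mono) simp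
    then show "eventually P (inf (filtercomap Y (at (Y b))) (principal {a<..<b}))"
      unfolding eventually_inf_principal eventually_filtercomap
      by (rule exI[of _ "\<lambda>v. Y t < v", OF conjI]) (use t less d(2) in \<open>auto simp: dist_real_def\<close>)
  qed
qed

context profile
begin

lemma speed_strict_mono_on:
  assumes Y: "\<And>s. (Y has_real_derivative sqrt ((w s)\<^sup>2 - (w' s)\<^sup>2)) (at s)"
    and sub: "\<And>s t x. s \<in> A \<Longrightarrow> t \<in> A \<Longrightarrow> s < x \<Longrightarrow> x < t \<Longrightarrow> x \<in> J"
  shows "strict_mono_on A Y"
proof (rule strict_mono_onI)
  fix s t assume st: "s \<in> A" "t \<in> A" "s < t"
  show "Y s < Y t"
  proof (rule DERIV_pos_imp_increasing_open[OF st(3)])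
    show "\<exists>y. (Y has_real_derivative y) (at x) \<and> 0 < y" if "s < x" "x < t" for x
      using Y speed_pos[OF sub[OF st(1,2) that]] by blast
    show "continuous_on {s..t} Y"
      using Y DERIV_isCont continuous_at_imp_continuous_on by blast
  qed
qed

text \<open>The tangent vector has components \<open>sqrt (w\<^sup>2 - w'\<^sup>2)\<close> and \<open>w' / w\<close>. At an end of \<open>J\<close> the first tends to
  \<open>0\<close> and the second to \<open>1\<close> or \<open>- 1\<close>.\<close>

lemma vertical_towards_endpoint:
  assumes Y: "\<And>s. (Y has_real_derivative sqrt ((w s)\<^sup>2 - (w' s)\<^sup>2)) (at s)"
    and e: "w e > 0" "\<bar>w' e\<bar> = w e"
    and F: "inf (filtercomap Y (at (Y e))) (principal J) \<le> at e"
  shows "vertical_towards J (\<lambda>s. vector [0, Y s, ln (w s)]) (Y e)"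
proof -
  define q where "q = (\<lambda>s. \<bar>w' s / w s\<bar> / sqrt ((w s)\<^sup>2 - (w' s)\<^sup>2 + (w' s / w s)\<^sup>2))"
  have tangent: "\<bar>sgn (vector_derivative (\<lambda>s. vector [0, Y s, ln (w s)] :: real^3) (at s)) $ 3\<bar> = q s"
    if s: "s \<in> J" for s
  proof -
    have "((\<lambda>s. ln (w s)) has_real_derivative w' s / w s) (at s)"
      using DERIV_chain2[OF DERIV_ln_divide[OF w_pos[OF s]] w] by simp
    then have "vector_derivative (\<lambda>s. vector [0, Y s, ln (w s)] :: real^3) (at s)
        = vector [0, sqrt ((w s)\<^sup>2 - (w' s)\<^sup>2), w' s / w s]"
      by (intro vector_derivative_at has_vector_derivative_vector3 Y) auto
    moreover have "\<bar>sgn (vector [0, r, t] :: real^3) $ 3\<bar> = \<bar>t\<bar> / sqrt (r\<^sup>2 + t\<^sup>2)" for r t :: real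
    proof -
      have "norm (vector [0, r, t] :: real^3) = sqrt (r\<^sup>2 + t\<^sup>2)"
        by (simp add: norm_vec_def L2_set_def sum_3)
      then show ?thesis by (simp add: sgn_div_norm abs_mult divide_inverse mult.commute)
    qed
    moreover have "(sqrt ((w s)\<^sup>2 - (w' s)\<^sup>2))\<^sup>2 = (w s)\<^sup>2 - (w' s)\<^sup>2"
      using speed_pos[OF s] by simp
    ultimately show ?thesis by (simp only: q_def)
  qed
  have "(w' e)\<^sup>2 = (w e)\<^sup>2" using e(2) by (metis power2_abs)
  then have q1: "(w e)\<^sup>2 - (w' e)\<^sup>2 + (w' e / w e)\<^sup>2 = 1" "\<bar>w' e / w e\<bar> = 1"
    using e by (simp_all add: power_divide abs_divide)
  have "isCont q e" unfolding q_def
    using DERIV_isCont[OF w] DERIV_isCont[OF w'] e(1) q1(1)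
    by (intro continuous_intros) auto
  moreover have "q e = 1" unfolding q_def q1 by simp
  ultimately have "(q \<longlongrightarrow> 1) (inf (filtercomap Y (at (Y e))) (principal J))"
    unfolding isCont_def using tendsto_mono[OF F] by metis
  then have "((\<lambda>s. \<bar>sgn (vector_derivative (\<lambda>s. vector [0, Y s, ln (w s)] :: real^3) (at s)) $ 3\<bar>) \<longlongrightarrow> 1)
      (inf (filtercomap Y (at (Y e))) (principal J))"
    by (rule Lim_transform_eventually) (auto simp: eventually_inf_principal tangent)
  then show ?thesis by (simp add: vertical_towards_def)
qed

text \<open>The sign \<open>\<sigma>\<close> tells convex-like profiles (\<open>\<sigma> = 1\<close>, a minimum at \<open>0\<close>) from concave-like ones
  (\<open>\<sigma> = - 1\<close>, a maximum at \<open>0\<close>). The graph is bounded because \<open>w\<close> stays positive at the ends of \<open>J\<close>,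
  so that \<open>ln w\<close> is continuous on the closed interval.\<close>

theorem bounded_profile_graph:
  assumes J_eq: "J = {-a<..<a}" and a: "a > 0" and pos: "\<And>s. s \<in> {-a..a} \<Longrightarrow> w s > 0"
    and Y: "\<And>s. (Y has_real_derivative sqrt ((w s)\<^sup>2 - (w' s)\<^sup>2)) (at s)"
    and ends: "\<bar>w' a\<bar> = w a" "\<bar>w' (- a)\<bar> = w (- a)"
    and shape: "\<sigma> \<in> {1, -1}"
      "\<And>s t. s \<in> J \<Longrightarrow> t \<in> J \<Longrightarrow> s < t \<Longrightarrow> t \<le> 0 \<Longrightarrow> \<sigma> * w t < \<sigma> * w s"
      "\<And>s t. s \<in> J \<Longrightarrow> t \<in> J \<Longrightarrow> 0 \<le> s \<Longrightarrow> s < t \<Longrightarrow> \<sigma> * w s < \<sigma> * w t"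
  shows "\<exists>f a0 b0. a0 < b0 \<and> is_graph J (\<lambda>s. vector [0, Y s, ln (w s)]) f {a0<..<b0} \<and>
      bounded (f ` {a0<..<b0}) \<and>
      (single_maximum f {a0<..<b0} \<or> single_minimum f {a0<..<b0}) \<and>
      vertical_towards J (\<lambda>s. vector [0, Y s, ln (w s)]) a0 \<and>
      vertical_towards J (\<lambda>s. vector [0, Y s, ln (w s)]) b0"
proof -
  have mono: "strict_mono_on {-a..a} Y" by (rule speed_strict_mono_on[OF Y]) (auto simp: J_eq)
  then have monoJ: "strict_mono_on J Y" by (auto simp: J_eq strict_mono_on_def)
  then have inj: "inj_on Y J" by (rule strict_mono_on_imp_inj_on)
  have cont: "continuous_on A Y" for A
    using Y DERIV_isCont continuous_at_imp_continuous_on by blast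
  have image: "Y ` J = {Y (- a)<..<Y a}"
  proof (intro equalityI subsetI)
    fix v assume "v \<in> Y ` J"
    then show "v \<in> {Y (- a)<..<Y a}"
      using mono by (auto simp: J_eq strict_mono_on_less)
  next
    fix v assume v: "v \<in> {Y (- a)<..<Y a}"
    then obtain s where "- a \<le> s" "s \<le> a" "Y s = v"
      using IVT'[of Y "- a" v a] a cont by auto
    with v show "v \<in> Y ` J" unfolding J_eq by (intro image_eqI[of _ _ s]) (auto simp: less_le)
  qed
  define f where "f = (\<lambda>v. ln (w (the_inv_into J Y v)))"
  have "is_graph J (\<lambda>s. vector [0, Y s, ln (w s)]) f {Y (- a)<..<Y a}"
    using is_graph_inverse[OF inj, of _ "\<lambda>s. ln (w s)"] by (simp add: image f_def)
  moreover have "Y (- a) < Y a" using mono a by (simp add: strict_mono_on_less)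
  moreover have "bounded (f ` {Y (- a)<..<Y a})"
  proof -
    have "compact ((\<lambda>s. ln (w s)) ` {-a..a})"
    proof (intro compact_continuous_image continuous_on_ln)
      show "continuous_on {-a..a} w"
        using w DERIV_isCont continuous_at_imp_continuous_on by blast
      show "\<forall>s\<in>{-a..a}. w s \<noteq> 0" using pos by (metis less_irrefl)
    qed auto
    moreover have "f (Y s) = ln (w s)" if "s \<in> J" for s
      using the_inv_into_f_f[OF inj that] by (simp add: f_def)
    then have "f ` {Y (- a)<..<Y a} \<subseteq> (\<lambda>s. ln (w s)) ` {-a..a}"
      unfolding image[symmetric] by (force simp: J_eq)
    ultimately show ?thesis using bounded_subset compact_imp_bounded by blast
  qed
  moreover have "single_minimum (\<lambda>v. \<sigma> * f v) {Y (- a)<..<Y a}"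
  proof -
    have log: "\<sigma> * ln (w s) < \<sigma> * ln (w t) \<longleftrightarrow> \<sigma> * w s < \<sigma> * w t" if "s \<in> J" "t \<in> J" for s t
      using that shape(1) w_pos by auto
    have "single_minimum (\<lambda>v. \<sigma> * ln (w (the_inv_into J Y v))) (Y ` J)"
    proof (rule graph_single_minimum[OF monoJ, where h = "\<lambda>s. \<sigma> * ln (w s)"])
      show "open (Y ` J)" by (simp add: image)
      show "0 \<in> J" using a by (simp add: J_eq)
    qed (use log shape in blast)+
    then show ?thesis by (simp add: image f_def)
  qed
  then have "single_maximum f {Y (- a)<..<Y a} \<or> single_minimum f {Y (- a)<..<Y a}"
    using shape(1) by (auto simp: single_maximum_def)
  moreover have "vertical_towards J (\<lambda>s. vector [0, Y s, ln (w s)]) (Y (- a))"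
    using endpoint_filter_le(1)[OF mono] a pos ends
    by (intro vertical_towards_endpoint[OF Y]) (auto simp: J_eq)
  moreover have "vertical_towards J (\<lambda>s. vector [0, Y s, ln (w s)]) (Y a)"
    using endpoint_filter_le(2)[OF mono] a pos ends
    by (intro vertical_towards_endpoint[OF Y]) (auto simp: J_eq)
  ultimately show ?thesis by blast
qed

end

section \<open>The profiles of the linear equation\<close>

lemma ex_tanh_eq:
  fixes x :: real
  assumes "\<bar>x\<bar> < 1" shows "\<exists>t. tanh t = x"
proof
  let ?t = "ln ((1 + x) / (1 - x)) / 2"
  have pos: "1 + x > 0" "1 - x > 0" using assms by auto
  then have "exp (- 2 * ?t) = (1 - x) / (1 + x)" by (simp add: exp_minus)
  then show "tanh ?t = x" using pos by (simp only: tanh_real_altdef) (simp add: field_simps)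
qed

lemma sinh_eq_tanh_cosh: "sinh x = tanh x * cosh (x::real)"
  by (simp add: tanh_def)

lemma frontier_intervals:
  fixes a b :: real
  shows "frontier {a<..} = {a}" and "a < b \<Longrightarrow> frontier {a<..<b} = {a, b}"
  by (auto simp: frontier_def interior_open)

lemma profile_constant: "profile 0 (\<lambda>_. 1) (\<lambda>_. 0) UNIV"
  by unfold_locales auto

lemma profile_linear: "profile 0 (\<lambda>s. s) (\<lambda>_. 1) {1<..}"
  by unfold_locales (auto simp: frontier_intervals is_interval_1)

lemma profile_cosh_entire:
  assumes k: "0 < k" "k \<le> 1"
  shows "profile (- k\<^sup>2) (\<lambda>s. cosh (k * s)) (\<lambda>s. k * sinh (k * s)) UNIV"
proof unfold_locales
  fix s :: real
  show "((\<lambda>s. cosh (k * s)) has_real_derivative k * sinh (k * s)) (at s)"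
    by (auto intro!: derivative_eq_intros)
  show "((\<lambda>s. k * sinh (k * s)) has_real_derivative - (- k\<^sup>2) * cosh (k * s)) (at s)"
    by (auto intro!: derivative_eq_intros simp: power2_eq_square)
  have "\<bar>k * sinh (k * s)\<bar> \<le> \<bar>sinh (k * s)\<bar>" using k by (simp add: abs_mult mult_left_le_one_le)
  also have "\<dots> < cosh (k * s)"
    using tanh_real_bounds[of "k * s"] by (auto simp: sinh_eq_tanh_cosh abs_mult abs_less_iff)
  finally show "\<bar>k * sinh (k * s)\<bar> < cosh (k * s)" .
qed auto

lemma profile_exp:
  assumes k: "0 < k" "k < 1"
  shows "profile (- k\<^sup>2) (\<lambda>s. exp (k * s)) (\<lambda>s. k * exp (k * s)) UNIV"
proof unfold_locales
  fix s :: real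
  show d: "((\<lambda>s. exp (k * s)) has_real_derivative k * exp (k * s)) (at s)"
    by (auto intro!: derivative_eq_intros)
  have "- (- k\<^sup>2) * exp (k * s) = k * (k * exp (k * s))" by (simp add: power2_eq_square)
  then show "((\<lambda>s. k * exp (k * s)) has_real_derivative - (- k\<^sup>2) * exp (k * s)) (at s)"
    using DERIV_cmult[OF d, of k] by (simp only:)
  show "\<bar>k * exp (k * s)\<bar> < exp (k * s)" using k by (simp add: abs_mult)
qed auto

text \<open>The interval starts where \<open>k coth (k s)\<close>, the logarithmic derivative of the profile, drops to \<open>1\<close>.\<close>

lemma profile_sinh:
  assumes k: "0 < k" "k < 1" and a: "tanh (k * a) = k"
  shows "profile (- k\<^sup>2) (\<lambda>s. sinh (k * s)) (\<lambda>s. k * cosh (k * s)) {a<..}"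
proof unfold_locales
  fix s :: real
  show "((\<lambda>s. sinh (k * s)) has_real_derivative k * cosh (k * s)) (at s)"
    by (auto intro!: derivative_eq_intros)
  show "((\<lambda>s. k * cosh (k * s)) has_real_derivative - (- k\<^sup>2) * sinh (k * s)) (at s)"
    by (auto intro!: derivative_eq_intros simp: power2_eq_square)
  show "\<bar>k * cosh (k * s)\<bar> < sinh (k * s)" if "s \<in> {a<..}"
  proof -
    have "tanh (k * a) < tanh (k * s)" using that k by simp
    then have "k < tanh (k * s)" unfolding a .
    then show ?thesis using k by (simp add: sinh_eq_tanh_cosh)
  qed
  show "sinh (k * s) \<le> \<bar>k * cosh (k * s)\<bar>" if "s \<in> frontier {a<..}"
    using that k by (simp add: frontier_intervals sinh_eq_tanh_cosh a)
qed (auto simp: is_interval_1)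

text \<open>For \<open>k > 1\<close> the slope condition fails eventually: the logarithmic derivative \<open>k tanh (k s)\<close> reaches
  \<open>1\<close> at \<open>a\<close>. For \<open>k \<le> 1\<close> it stays below \<open>1\<close>, as in \<open>profile_cosh_entire\<close>.\<close>

lemma profile_cosh_bounded:
  assumes k: "1 < k" and a: "k * tanh (k * a) = 1"
  shows "profile (- k\<^sup>2) (\<lambda>s. cosh (k * s)) (\<lambda>s. k * sinh (k * s)) {-a<..<a}"
proof -
  have "tanh (k * a) > 0" using a k by (smt (verit) mult_nonneg_nonpos)
  then have "a > 0" using k by (simp add: zero_less_mult_iff)
  have eq: "\<bar>k * sinh (k * s)\<bar> = (k * tanh (k * \<bar>s\<bar>)) * cosh (k * s)" for s
    using k tanh_real_abs[of "k * s"] by (simp add: sinh_eq_tanh_cosh abs_mult)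
  show ?thesis
  proof unfold_locales
    fix s :: real
    show "((\<lambda>s. cosh (k * s)) has_real_derivative k * sinh (k * s)) (at s)"
      by (auto intro!: derivative_eq_intros)
    show "((\<lambda>s. k * sinh (k * s)) has_real_derivative - (- k\<^sup>2) * cosh (k * s)) (at s)"
      by (auto intro!: derivative_eq_intros simp: power2_eq_square)
    show "\<bar>k * sinh (k * s)\<bar> < cosh (k * s)" if "s \<in> {-a<..<a}"
    proof -
      have "k * tanh (k * \<bar>s\<bar>) < k * tanh (k * a)" using that k by auto
      then show ?thesis unfolding eq a by simp
    qed
    show "cosh (k * s) \<le> \<bar>k * sinh (k * s)\<bar>" if "s \<in> frontier {-a<..<a}"
    proof -
      have "\<bar>s\<bar> = a" using that \<open>a > 0\<close> by (auto simp: frontier_intervals)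
      then show ?thesis unfolding eq by (simp add: a)
    qed
  qed (auto simp: is_interval_1)
qed

lemma cos_profile_bounds:
  assumes k: "0 < k" and a: "a = arctan (1 / k) / k"
  shows "a > 0"
    and "\<bar>s\<bar> \<le> a \<Longrightarrow> cos (k * s) > 0"
    and "\<bar>s\<bar> < a \<Longrightarrow> \<bar>- k * sin (k * s)\<bar> < cos (k * s)"
    and "\<bar>s\<bar> = a \<Longrightarrow> \<bar>- k * sin (k * s)\<bar> = cos (k * s)"
proof -
  show "a > 0" using k by (simp add: a)
  have ka: "k * a = arctan (1 / k)" using k by (simp add: a)
  have le: "\<bar>k * s\<bar> < pi / 2" if "\<bar>s\<bar> \<le> a"
  proof -
    have "\<bar>k * s\<bar> \<le> k * a" using that k by (simp add: abs_mult)
    then show ?thesis using arctan_ubound[of "1 / k"] ka by simp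
  qed
  show cos: "cos (k * s) > 0" if "\<bar>s\<bar> \<le> a"
    using le[OF that] by (intro cos_gt_zero_pi) auto
  have eq: "\<bar>- k * sin (k * s)\<bar> = (k * tan (k * \<bar>s\<bar>)) * cos (k * s)" if "\<bar>s\<bar> \<le> a"
  proof -
    have "\<bar>tan (k * s)\<bar> = tan (k * \<bar>s\<bar>)"
    proof (cases "s \<ge> 0")
      case True
      then have "tan (k * s) \<ge> 0" using le[OF that] k tan_gt_zero[of "k * s"] by (cases "s = 0") auto
      then show ?thesis using True by simp
    next
      case False
      then have "tan (k * - s) > 0" using le[OF that] k by (intro tan_gt_zero) (auto simp: mult_less_0_iff)
      then show ?thesis using False by simp
    qed
    moreover have "sin (k * s) = tan (k * s) * cos (k * s)" using cos[OF that] by (simp add: tan_def)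
    ultimately show ?thesis using k cos[OF that] by (simp add: abs_mult)
  qed
  have one: "k * tan (k * a) = 1" using k by (simp add: ka tan_arctan)
  show "\<bar>- k * sin (k * s)\<bar> < cos (k * s)" if "\<bar>s\<bar> < a"
  proof -
    have "tan (k * \<bar>s\<bar>) < tan (k * a)"
    proof (rule tan_monotone)
      have "0 \<le> k * \<bar>s\<bar>" using k by simp
      then show "- (pi / 2) < k * \<bar>s\<bar>" using pi_gt_zero by linarith
      show "k * \<bar>s\<bar> < k * a" using that k by simp
      show "k * a < pi / 2" unfolding ka by (rule arctan_ubound)
    qed
    then have "k * tan (k * \<bar>s\<bar>) < 1" using k by (simp flip: one)
    then show ?thesis using eq cos that by simp
  qed
  show "\<bar>- k * sin (k * s)\<bar> = cos (k * s)" if "\<bar>s\<bar> = a"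
    using eq that one by simp
qed

lemma profile_cos:
  assumes k: "0 < k" and a: "a = arctan (1 / k) / k"
  shows "profile (k\<^sup>2) (\<lambda>s. cos (k * s)) (\<lambda>s. - k * sin (k * s)) {-a<..<a}"
proof unfold_locales
  fix s :: real
  show "((\<lambda>s. cos (k * s)) has_real_derivative - k * sin (k * s)) (at s)"
    by (auto intro!: derivative_eq_intros)
  show "((\<lambda>s. - k * sin (k * s)) has_real_derivative - k\<^sup>2 * cos (k * s)) (at s)"
    by (auto intro!: derivative_eq_intros simp: power2_eq_square)
  show "\<bar>- k * sin (k * s)\<bar> < cos (k * s)" if "s \<in> {-a<..<a}"
    using that by (intro cos_profile_bounds(3)[OF k a]) auto
  show "cos (k * s) \<le> \<bar>- k * sin (k * s)\<bar>" if "s \<in> frontier {-a<..<a}"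
  proof -
    have "\<bar>s\<bar> = a" using that cos_profile_bounds(1)[OF k a] by (auto simp: frontier_intervals)
    then show ?thesis using cos_profile_bounds(4)[OF k a] by simp
  qed
qed (auto simp: is_interval_1)

section \<open>Growth of a function with derivative bounded below\<close>

lemma linear_lower_bound:
  fixes Y :: "real \<Rightarrow> real"
  assumes "p \<le> s" and Y: "\<And>x. p \<le> x \<Longrightarrow> x \<le> s \<Longrightarrow> (Y has_real_derivative D x) (at x)"
    and m: "\<And>x. p \<le> x \<Longrightarrow> x \<le> s \<Longrightarrow> m \<le> D x"
  shows "Y p + m * (s - p) \<le> Y s"
proof -
  have "Y p - m * p \<le> Y s - m * s"
  proof (rule DERIV_nonneg_imp_nondecreasing[OF assms(1)])
    fix x assume x: "p \<le> x" "x \<le> s"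
    have "((\<lambda>x. Y x - m * x) has_real_derivative D x - m) (at x)"
      using Y[OF x] by (auto intro!: derivative_eq_intros)
    then show "\<exists>y. ((\<lambda>x. Y x - m * x) has_real_derivative y) (at x) \<and> 0 \<le> y"
      using m[OF x] by (intro exI[of _ "D x - m"]) simp
  qed
  then show ?thesis by (simp add: algebra_simps)
qed

lemma image_greaterThan:
  fixes Y :: "real \<Rightarrow> real"
  assumes mono: "strict_mono_on {a..} Y"
    and Y: "\<And>x. (Y has_real_derivative D x) (at x)"
    and m: "m > 0" "\<And>x. p \<le> x \<Longrightarrow> m \<le> D x" and p: "a \<le> p"
  shows "Y ` {a<..} = {Y a<..}"
proof (intro equalityI subsetI)
  fix v assume "v \<in> Y ` {a<..}"
  then show "v \<in> {Y a<..}" using mono by (auto simp: strict_mono_on_less)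
next
  fix v assume v: "v \<in> {Y a<..}"
  define t where "t = p + \<bar>v - Y p\<bar> / m"
  have t: "p \<le> t" using m(1) by (simp add: t_def)
  have "Y p + m * (t - p) \<le> Y t" by (rule linear_lower_bound[OF t Y m(2)])
  then have "v \<le> Y t" using m(1) by (simp add: t_def)
  moreover have "continuous_on {a..t} Y"
    using Y DERIV_isCont continuous_at_imp_continuous_on by blast
  ultimately obtain s where "a \<le> s" "s \<le> t" "Y s = v"
    using IVT'[of Y a v t] v p t by auto
  then show "v \<in> Y ` {a<..}" using v by (intro image_eqI[of _ _ s]) (auto simp: less_le)
qed

lemma range_UNIV_if_deriv_ge:
  fixes Y :: "real \<Rightarrow> real"
  assumes Y: "\<And>x. (Y has_real_derivative D x) (at x)" and D: "\<And>x. 1 \<le> D x"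
  shows "range Y = UNIV"
proof (intro equalityI subsetI UNIV_I)
  fix v
  define r where "r = \<bar>v - Y 0\<bar>"
  have "Y 0 + 1 * (r - 0) \<le> Y r" "Y (- r) + 1 * (0 - (- r)) \<le> Y 0"
    by (rule linear_lower_bound[OF _ Y D]; simp add: r_def)+
  then have "Y (- r) \<le> v" "v \<le> Y r" by (auto simp: r_def)
  moreover have "continuous_on {-r..r} Y"
    using Y DERIV_isCont continuous_at_imp_continuous_on by blast
  ultimately obtain s where "Y s = v"
    using IVT'[of Y "- r" v r] by (auto simp: r_def)
  then show "v \<in> range Y" by blast
qed

section \<open>The classification\<close>

text \<open>Solutions of \<open>u'' = 0\<close> are affine. A constant \<open>u\<close> means constant height, and any other one becomes
  \<open>u = s\<close> after a change of parameter, with \<open>\<bar>u'\<bar> < u\<close> exactly for \<open>s > 1\<close>.\<close>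

lemma classification_flat:
  assumes max: "maximal_cgc_solution 0 I y z \<theta>" and p: "p \<in> I"
    and cos: "\<And>s. s \<in> I \<Longrightarrow> cos (\<theta> s) \<noteq> 0"
  shows "invariant_surface I y z \<in> foliation3 \<or>
    up_to_integration_constants I (gen_curve y z) {1<..}
      (\<lambda>s. vector [0, (s * sqrt (s\<^sup>2 - 1) - ln (s + sqrt (s\<^sup>2 - 1))) / 2, ln s])"
proof (cases "sin (\<theta> p) = 0")
  case True
  interpret profile 0 "\<lambda>_. 1" "\<lambda>_. 0" UNIV by (rule profile_constant)
  obtain s0 M \<tau> b where M: "M > 0" and \<tau>: "\<tau> \<in> {1, -1}" and I: "I = UNIV"
    and z: "\<And>s. s \<in> I \<Longrightarrow> z s = ln M" and y: "\<And>s. s \<in> I \<Longrightarrow> y s = b + \<tau> * M * (s - s0)"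
  proof (rule maximal_solution_from_profile[OF max p cos, of "\<lambda>s. s" 1 0])
    show "((\<lambda>s. s) has_real_derivative sqrt (1\<^sup>2 - 0\<^sup>2)) (at s)" for s :: real by simp
  qed (use True in auto)
  \<comment> \<open>The generating curve is a full horizontal line, since \<open>y\<close> is affine on the whole parameter line.\<close>
  have "invariant_surface I y z = {q. q$3 = ln M}"
  proof (intro equalityI subsetI)
    fix q assume "q \<in> invariant_surface I y z"
    then show "q \<in> {q. q$3 = ln M}" using z by (auto simp: invariant_surface_def surface_param_def)
  next
    fix q :: "real^3" assume q: "q \<in> {q. q$3 = ln M}"
    define s where "s = s0 + \<tau> * (q$2 - b) / M"
    have "y s = q$2" using y[of s] I M \<tau> by (auto simp: s_def)
    then have "q = surface_param y z (vector [s, q$1])"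
      using q z[of s] I by (simp add: surface_param_def vec_eq_iff forall_3)
    then show "q \<in> invariant_surface I y z" by (auto simp: invariant_surface_def I)
  qed
  then show ?thesis by (auto simp: foliation3_def)
next
  case False
  let ?r = "sin (\<theta> p)"
  interpret profile 0 "\<lambda>s. s" "\<lambda>_. 1" "{1<..}" by (rule profile_linear)
  have "up_to_integration_constants I (gen_curve y z) {1<..}
      (\<lambda>s. vector [0, (s * sqrt (s\<^sup>2 - 1) - ln (s + sqrt (s\<^sup>2 - 1))) / 2, ln s])"
  proof (rule profile_up_to_integration_constants[OF max p cos])
    show "sgn ?r \<in> {1, - 1}" using False by (auto simp: sgn_if)
    have "\<bar>?r\<bar> < 1" using abs_sin_less_1[OF cos[OF p]] .
    then show "1 / \<bar>?r\<bar> \<in> {1<..}" using False by simp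
    show "sgn ?r * 1 = ?r * (1 / \<bar>?r\<bar>)" using False by (simp add: sgn_if)
    fix s :: real assume s: "s \<in> {1<..}"
    define q where "q = sqrt (s\<^sup>2 - 1)"
    have "s\<^sup>2 - 1 > 0" using s by (simp add: power2_eq_square less_1_mult)
    then have q: "q > 0" "q\<^sup>2 = s\<^sup>2 - 1" by (simp_all add: q_def)
    have dq: "((\<lambda>s. sqrt (s\<^sup>2 - 1)) has_real_derivative s / q) (at s)"
    proof -
      have "((\<lambda>s. s\<^sup>2 - 1) has_real_derivative 2 * s) (at s)"
        by (auto intro!: derivative_eq_intros)
      then have "((\<lambda>s. sqrt (s\<^sup>2 - 1)) has_real_derivative inverse q / 2 * (2 * s)) (at s)"
        unfolding q_def using DERIV_real_sqrt[OF \<open>s\<^sup>2 - 1 > 0\<close>]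
        by (rule DERIV_chain2[where f = sqrt and g = "\<lambda>s. s\<^sup>2 - 1", rotated])
      moreover have "inverse q / 2 * (2 * s) = s / q" using q(1) by (simp add: field_simps)
      ultimately show ?thesis by (simp only:)
    qed
    have "((\<lambda>s. ln (s + sqrt (s\<^sup>2 - 1))) has_real_derivative 1 / (s + q) * (1 + s / q)) (at s)"
    proof (rule DERIV_chain2[where g = "\<lambda>s. s + sqrt (s\<^sup>2 - 1)" and f = ln])
      show "(ln has_real_derivative 1 / (s + q)) (at (s + sqrt (s\<^sup>2 - 1)))"
        unfolding q_def using q(1) s by (intro DERIV_ln_divide) (simp add: add_pos_pos flip: q_def)
      show "((\<lambda>s. s + sqrt (s\<^sup>2 - 1)) has_real_derivative 1 + s / q) (at s)"
        by (intro DERIV_add DERIV_ident dq)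
    qed
    moreover have "1 / (s + q) * (1 + s / q) = 1 / q"
    proof -
      have "s + q > 0" using q(1) s by auto
      then show ?thesis using q(1) by (simp add: divide_simps)
    qed
    ultimately have dl: "((\<lambda>s. ln (s + sqrt (s\<^sup>2 - 1))) has_real_derivative 1 / q) (at s)" by simp
    have "((\<lambda>s. (s * sqrt (s\<^sup>2 - 1) - ln (s + sqrt (s\<^sup>2 - 1))) / 2) has_real_derivative
        (1 * q + s / q * s - 1 / q) / 2) (at s)"
      unfolding q_def
      by (intro DERIV_cdivide DERIV_diff DERIV_mult DERIV_ident dq[unfolded q_def] dl[unfolded q_def])
    moreover have "(1 * q + s / q * s - 1 / q) / 2 = q"
    proof -
      have "s / q * s - 1 / q = q\<^sup>2 / q" unfolding q(2) using q(1) by (simp add: field_simps power2_eq_square)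
      then show ?thesis using q(1) by (simp add: power2_eq_square)
    qed
    ultimately show "((\<lambda>s. (s * sqrt (s\<^sup>2 - 1) - ln (s + sqrt (s\<^sup>2 - 1))) / 2) has_real_derivative
        sqrt (s\<^sup>2 - 1\<^sup>2)) (at s)" by (simp only: one_power2 q_def[symmetric])
  qed
  then show ?thesis by blast
qed

text \<open>The point at which the profile \<open>cosh (k s)\<close> has the logarithmic derivative \<open>r\<close>.\<close>

lemma cosh_profile_match:
  fixes r k :: real
  assumes "0 < k" "\<bar>r\<bar> < k"
  obtains s where "tanh (k * s) = r / k" "k * sinh (k * s) = r * cosh (k * s)"
proof -
  obtain t where t: "tanh t = r / k" using ex_tanh_eq[of "r / k"] assms by auto
  show thesis
    by (rule that[of "t / k"]) (use assms t in \<open>simp_all add: sinh_eq_tanh_cosh\<close>)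
qed

text \<open>For \<open>c = - 1\<close> the profile is \<open>cosh\<close>, and \<open>cosh\<^sup>2 - sinh\<^sup>2 = 1\<close> makes \<open>y\<close> itself the arc length
  parameter.\<close>

lemma classification_minus_one:
  assumes max: "maximal_cgc_solution (- 1) I y z \<theta>" and p: "p \<in> I"
    and cos: "\<And>s. s \<in> I \<Longrightarrow> cos (\<theta> s) \<noteq> 0"
  shows "\<exists>\<beta>. up_to_integration_constants I (gen_curve y z) UNIV \<beta> \<and>
    is_graph UNIV \<beta> (\<lambda>v. ln (cosh v)) UNIV"
proof -
  interpret profile "- 1\<^sup>2" "\<lambda>s. cosh (1 * s)" "\<lambda>s. 1 * sinh (1 * s)" UNIV
    by (rule profile_cosh_entire) auto
  have "\<bar>sin (\<theta> p)\<bar> < 1" using abs_sin_less_1[OF cos[OF p]] .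
  then obtain s where s: "1 * sinh (1 * s) = sin (\<theta> p) * cosh (1 * s)"
    using cosh_profile_match[of 1 "sin (\<theta> p)"] by auto
  have "up_to_integration_constants I (gen_curve y z) UNIV (\<lambda>s. vector [0, s, ln (cosh (1 * s))])"
    by (rule profile_up_to_integration_constants[of I y z \<theta> p _ 1 s])
      (use max p cos s in \<open>auto simp: cosh_square_eq\<close>)
  then show ?thesis by (intro exI conjI) (auto simp: is_graph_def)
qed

text \<open>With \<open>r = sin (\<theta> p)\<close> the logarithmic derivative of \<open>u\<close> at one point, the solution
  \<open>u = A exp (k s) + B exp (- k s)\<close> is of the form \<open>cosh\<close>, \<open>exp\<close> or \<open>sinh\<close> according to whether
  \<open>\<bar>r\<bar>\<close> is smaller than, equal to or larger than \<open>k\<close>: this is the sign of \<open>A B\<close>. The orientation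
  of the curve makes \<open>u\<close> increasing in the last two cases.\<close>

lemma classification_between:
  assumes k: "0 < k" "k < 1"
    and max: "maximal_cgc_solution (- k\<^sup>2) I y z \<theta>" and p: "p \<in> I"
    and cos: "\<And>s. s \<in> I \<Longrightarrow> cos (\<theta> s) \<noteq> 0"
  shows "\<exists>J \<beta>. up_to_integration_constants I (gen_curve y z) J \<beta> \<and>
        ((\<exists>a. a \<noteq> 0 \<and> is_graph J \<beta> (\<lambda>v. ln (a * v)) {v. a * v > 0}) \<or>
         (\<exists>f. is_graph J \<beta> f UNIV \<and> single_minimum f UNIV) \<or>
         (\<exists>f a0. is_graph J \<beta> f {a0<..} \<and> (mono_on {a0<..} f \<or> antimono_on {a0<..} f)))"
proof -
  define r where "r = sin (\<theta> p)"
  have r1: "\<bar>r\<bar> < 1" unfolding r_def using abs_sin_less_1[OF cos[OF p]] .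
  consider "\<bar>r\<bar> < k" | "\<bar>r\<bar> = k" | "k < \<bar>r\<bar>" by linarith
  then show ?thesis
  proof cases
    case 1
    interpret profile "- k\<^sup>2" "\<lambda>s. cosh (k * s)" "\<lambda>s. k * sinh (k * s)" UNIV
      using k by (intro profile_cosh_entire) auto
    obtain s1 where s1: "k * sinh (k * s1) = r * cosh (k * s1)"
      using cosh_profile_match[OF k(1) 1] by blast
    obtain Y where Y: "\<And>s. (Y has_real_derivative sqrt ((cosh (k * s))\<^sup>2 - (k * sinh (k * s))\<^sup>2)) (at s)"
      using antiderivative_exists by blast
    let ?\<beta> = "\<lambda>s. vector [0, Y s, ln (cosh (k * s))] :: real^3"
    let ?f = "\<lambda>v. ln (cosh (k * the_inv_into UNIV Y v))"
    have up: "up_to_integration_constants I (gen_curve y z) UNIV ?\<beta>"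
      by (rule profile_up_to_integration_constants[OF max p cos Y, of 1 s1]) (use s1 in \<open>auto simp: r_def\<close>)
    have "1 \<le> sqrt ((cosh (k * s))\<^sup>2 - (k * sinh (k * s))\<^sup>2)" for s
    proof -
      have "k\<^sup>2 * (sinh (k * s))\<^sup>2 \<le> (sinh (k * s))\<^sup>2"
        using k by (intro mult_left_le_one_le) (auto simp: power_le_one)
      then show ?thesis by (simp add: cosh_square_eq power_mult_distrib)
    qed
    then have range: "range Y = UNIV" by (rule range_UNIV_if_deriv_ge[OF Y])
    have mono: "strict_mono_on UNIV Y" by (rule speed_strict_mono_on[OF Y]) simp
    have "is_graph UNIV ?\<beta> ?f UNIV"
      using is_graph_inverse[OF strict_mono_on_imp_inj_on[OF mono], of ?\<beta> "\<lambda>s. ln (cosh (k * s))"]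
      by (simp add: range)
    moreover have "single_minimum ?f (range Y)"
    proof (rule graph_single_minimum[OF mono, of 0 "\<lambda>s. ln (cosh (k * s))"])
      show "ln (cosh (k * t)) < ln (cosh (k * s))" if "s < t" "t \<le> 0" for s t
      proof -
        have "cosh (k * - t) < cosh (k * - s)"
          using that k by (intro cosh_real_strict_mono) (auto simp: mult_nonneg_nonpos)
        then show ?thesis by simp
      qed
      show "ln (cosh (k * s)) < ln (cosh (k * t))" if "0 \<le> s" "s < t" for s t
        using that k cosh_real_strict_mono[of "k * s" "k * t"] by simp
    qed (auto simp: range)
    then have "single_minimum ?f UNIV" unfolding range .
    ultimately show ?thesis using up
      by (intro exI[of _ UNIV] exI[of _ ?\<beta>] conjI disjI2 disjI1) blast+
  next
    case 2
    interpret profile "- k\<^sup>2" "\<lambda>s. exp (k * s)" "\<lambda>s. k * exp (k * s)" UNIV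
      using k by (intro profile_exp) auto
    define a where "a = sqrt (1 - k\<^sup>2) / k"
    have "k\<^sup>2 < 1" using k by (simp add: power_less_one_iff)
    then have a: "a > 0" using k by (simp add: a_def)
    let ?\<beta> = "\<lambda>s. vector [0, a * exp (k * s), ln (exp (k * s))] :: real^3"
    have "up_to_integration_constants I (gen_curve y z) UNIV ?\<beta>"
    proof (rule profile_up_to_integration_constants[OF max p cos, of _ "sgn r" 0])
      fix s :: real
      have "((\<lambda>s. a * exp (k * s)) has_real_derivative a * (exp (k * s) * k)) (at s)"
        by (auto intro!: derivative_eq_intros)
      moreover have "a * (exp (k * s) * k) = sqrt ((exp (k * s))\<^sup>2 - (k * exp (k * s))\<^sup>2)"
      proof -
        have "(exp (k * s))\<^sup>2 - (k * exp (k * s))\<^sup>2 = (1 - k\<^sup>2) * (exp (k * s))\<^sup>2"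
          by (simp add: algebra_simps)
        then have "sqrt ((exp (k * s))\<^sup>2 - (k * exp (k * s))\<^sup>2) = sqrt (1 - k\<^sup>2) * exp (k * s)"
          by (simp add: real_sqrt_mult)
        then show ?thesis using k by (simp add: a_def)
      qed
      ultimately show "((\<lambda>s. a * exp (k * s)) has_real_derivative
        sqrt ((exp (k * s))\<^sup>2 - (k * exp (k * s))\<^sup>2)) (at s)" by simp
    next
      show "sgn r \<in> {1, - 1}" using 2 k by (auto simp: sgn_if)
      show "sgn r * (k * exp (k * 0)) = sin (\<theta> p) * exp (k * 0)"
        using 2 by (auto simp: sgn_if r_def abs_if split: if_splits)
    qed auto
    moreover have "is_graph UNIV ?\<beta> (\<lambda>v. ln (1 / a * v)) {v. 1 / a * v > 0}"
      unfolding is_graph_def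
    proof (intro equalityI subsetI)
      fix q assume "q \<in> range ?\<beta>"
      then obtain s where q: "q = ?\<beta> s" by blast
      show "q \<in> {vector [0, v, ln (1 / a * v)] |v. v \<in> {v. 0 < 1 / a * v}}"
        unfolding mem_Collect_eq q using a by (intro exI[of _ "a * exp (k * s)"]) simp
    next
      fix q :: "real^3" assume "q \<in> {vector [0, v, ln (1 / a * v)] |v. v \<in> {v. 0 < 1 / a * v}}"
      then obtain v where v: "1 / a * v > 0" and q: "q = vector [0, v, ln (1 / a * v)]" by blast
      have "v > 0" using v a by (simp add: zero_less_divide_iff)
      then show "q \<in> range ?\<beta>" unfolding q
        using a k by (intro image_eqI[of _ _ "ln (1 / a * v) / k"]) simp_all
    qed
    moreover have "1 / a \<noteq> 0" using a by simp
    ultimately show ?thesis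
      by (intro exI[of _ UNIV] exI[of _ ?\<beta>] conjI disjI1) blast+
  next
    case 3
    \<comment> \<open>The interval \<open>J\<close> starts at \<open>e\<close>, where \<open>tanh (k e) = k\<close>. The matching point \<open>t / k\<close> has
      \<open>tanh t = k / \<bar>r\<bar>\<close> and lies beyond \<open>e\<close> because \<open>\<bar>r\<bar> < 1\<close>.\<close>
    obtain a where "tanh a = k" using ex_tanh_eq[of k] k by auto
    then have a: "tanh (k * (a / k)) = k" using k by simp
    define e where "e = a / k"
    note e = a[folded e_def]
    have epos: "e > 0" using e k by (metis tanh_real_pos_iff zero_less_mult_pos)
    interpret profile "- k\<^sup>2" "\<lambda>s. sinh (k * s)" "\<lambda>s. k * cosh (k * s)" "{e<..}"
      using k e by (rule profile_sinh)
    have "k / \<bar>r\<bar> < 1" using 3 k by simp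
    then obtain t where t: "tanh t = k / \<bar>r\<bar>" using ex_tanh_eq[of "k / \<bar>r\<bar>"] k by auto
    have "k < k / \<bar>r\<bar>" using 3 k r1 by (simp add: less_divide_eq)
    then have "tanh (k * e) < tanh (k * (t / k))" using e t k by simp
    then have s1: "e < t / k" by (simp only: tanh_real_less_iff mult_less_cancel_left_pos[OF k(1)])
    obtain Y where Y: "\<And>s. (Y has_real_derivative sqrt ((sinh (k * s))\<^sup>2 - (k * cosh (k * s))\<^sup>2)) (at s)"
      using antiderivative_exists by blast
    let ?\<beta> = "\<lambda>s. vector [0, Y s, ln (sinh (k * s))] :: real^3"
    let ?f = "\<lambda>v. ln (sinh (k * the_inv_into {e<..} Y v))"
    have up: "up_to_integration_constants I (gen_curve y z) {e<..} ?\<beta>"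
    proof (rule profile_up_to_integration_constants[OF max p cos Y, of "sgn r" "t / k"])
      show "sgn r \<in> {1, - 1}" using 3 k by (auto simp: sgn_if)
      have "sinh (k * (t / k)) = k / \<bar>r\<bar> * cosh (k * (t / k))"
        using t k by (simp add: sinh_eq_tanh_cosh)
      then show "sgn r * (k * cosh (k * (t / k))) = sin (\<theta> p) * sinh (k * (t / k))"
        using 3 k by (simp add: sgn_if flip: r_def)
    qed (use s1 in auto)
    have mono: "strict_mono_on {e..} Y" by (rule speed_strict_mono_on[OF Y]) auto
    then have monoJ: "strict_mono_on {e<..} Y" by (auto simp: strict_mono_on_def)
    then have inj: "inj_on Y {e<..}" by (rule strict_mono_on_imp_inj_on)
    \<comment> \<open>The speed of \<open>Y\<close> increases along the curve, so from \<open>e + 1\<close> on it is bounded below and the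
      range of \<open>Y\<close> is unbounded.\<close>
    have "Y ` {e<..} = {Y e<..}"
    proof (rule image_greaterThan[OF mono Y])
      show "0 < sqrt ((sinh (k * (e + 1)))\<^sup>2 - (k * cosh (k * (e + 1)))\<^sup>2)"
        by (rule speed_pos) simp
      show "e \<le> e + 1" by simp
      fix x assume x: "e + 1 \<le> x"
      have "sinh (k * (e + 1)) \<le> sinh (k * x)" using x k by simp
      moreover have "0 \<le> sinh (k * (e + 1))" using epos k by simp
      ultimately have "(sinh (k * (e + 1)))\<^sup>2 \<le> (sinh (k * x))\<^sup>2" by (rule power_mono)
      moreover have "k\<^sup>2 \<le> 1" using k by (simp add: power_le_one)
      ultimately have "(1 - k\<^sup>2) * (sinh (k * (e + 1)))\<^sup>2 \<le> (1 - k\<^sup>2) * (sinh (k * x))\<^sup>2"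
        by (intro mult_left_mono) auto
      then show "sqrt ((sinh (k * (e + 1)))\<^sup>2 - (k * cosh (k * (e + 1)))\<^sup>2)
          \<le> sqrt ((sinh (k * x))\<^sup>2 - (k * cosh (k * x))\<^sup>2)"
        by (simp add: power_mult_distrib cosh_square_eq algebra_simps)
    qed
    then have image: "{Y e<..} = Y ` {e<..}" ..
    have "is_graph {e<..} ?\<beta> ?f {Y e<..}" unfolding image
      using is_graph_inverse[OF inj, of ?\<beta> "\<lambda>s. ln (sinh (k * s))"] by simp
    moreover have "mono_on {Y e<..} ?f" unfolding image
    proof (rule mono_onI)
      fix u v assume "u \<in> Y ` {e<..}" "v \<in> Y ` {e<..}" "u \<le> v"
      then obtain s t where st: "e < s" "e < t" "u = Y s" "v = Y t" by auto
      then have "s \<le> t" using \<open>u \<le> v\<close> strict_mono_on_less_eq[OF monoJ] by simp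
      moreover have "0 < sinh (k * s)" "0 < sinh (k * t)" using st epos k by simp_all
      ultimately show "?f u \<le> ?f v" using st k by (simp add: the_inv_into_f_f[OF inj])
    qed
    ultimately show ?thesis using up
      by (intro exI[of _ "{e<..}"] exI[of _ ?\<beta>] conjI disjI2) blast+
  qed
qed

definition bounded_vertical_graph :: "real set \<Rightarrow> (real \<Rightarrow> real^3) \<Rightarrow> bool" where
  "bounded_vertical_graph J \<beta> \<longleftrightarrow>
     (\<exists>f a0 b0. a0 < b0 \<and> is_graph J \<beta> f {a0<..<b0} \<and> bounded (f ` {a0<..<b0}) \<and>
        (single_maximum f {a0<..<b0} \<or> single_minimum f {a0<..<b0}) \<and>
        vertical_towards J \<beta> a0 \<and> vertical_towards J \<beta> b0)"

text \<open>Solutions oscillate like \<open>cos (k s)\<close>, and \<open>\<bar>u'\<bar> < u\<close> holds between the points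
  where \<open>k \<bar>tan (k s)\<bar>\<close> reaches \<open>1\<close>. The single extremum is the maximum of the cosine.\<close>

lemma classification_positive:
  assumes k: "0 < k"
    and max: "maximal_cgc_solution (k\<^sup>2) I y z \<theta>" and p: "p \<in> I"
    and cos: "\<And>s. s \<in> I \<Longrightarrow> cos (\<theta> s) \<noteq> 0"
  shows "\<exists>J \<beta>. up_to_integration_constants I (gen_curve y z) J \<beta> \<and> bounded_vertical_graph J \<beta>"
proof -
  define r where "r = sin (\<theta> p)"
  have r1: "\<bar>r\<bar> < 1" unfolding r_def using abs_sin_less_1[OF cos[OF p]] .
  define a where "a = arctan (1 / k) / k"
  note bounds = cos_profile_bounds[OF k a_def]
  interpret profile "k\<^sup>2" "\<lambda>s. cos (k * s)" "\<lambda>s. - k * sin (k * s)" "{-a<..<a}"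
    using k a_def by (rule profile_cos)
  obtain Y where Y: "\<And>s. (Y has_real_derivative sqrt ((cos (k * s))\<^sup>2 - (- k * sin (k * s))\<^sup>2)) (at s)"
    using antiderivative_exists by blast
  let ?\<beta> = "\<lambda>s. vector [0, Y s, ln (cos (k * s))] :: real^3"
  define t where "t = - arctan (r / k)"
  have "\<bar>t\<bar> < k * a"
  proof -
    have "arctan (r / k) < arctan (1 / k)" "arctan (- r / k) < arctan (1 / k)"
      using r1 k by (auto simp only: arctan_less_iff intro!: divide_strict_right_mono)
    then show ?thesis using k by (simp add: t_def a_def arctan_minus abs_less_iff)
  qed
  then have tJ: "t / k \<in> {-a<..<a}" using k by (auto simp: field_simps abs_less_iff)
  have "sin t = tan t * cos t" using cos_arctan_not_zero[of "r / k"] by (simp add: tan_def t_def)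
  then have match: "- k * sin t = r * cos t" using k by (simp add: t_def tan_arctan)
  have up: "up_to_integration_constants I (gen_curve y z) {-a<..<a} ?\<beta>"
    by (rule profile_up_to_integration_constants[OF max p cos Y, of 1 "t / k"])
      (use tJ match k in \<open>simp_all add: r_def\<close>)
  have less_pi: "k * s < pi / 2" "- (pi / 2) < k * s" if "s \<in> {-a<..<a}" for s
  proof -
    have "\<bar>k * s\<bar> < k * a" using that k by (simp add: abs_mult abs_less_iff)
    moreover have "k * a = arctan (1 / k)" using k by (simp add: a_def)
    then have "k * a < pi / 2" using arctan_ubound by simp
    ultimately show "k * s < pi / 2" "- (pi / 2) < k * s" by linarith+
  qed
  have "bounded_vertical_graph {-a<..<a} ?\<beta>"
    unfolding bounded_vertical_graph_def
  proof (rule bounded_profile_graph[OF refl bounds(1) _ Y, of "- 1"])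
    show "- 1 * cos (k * t) < - 1 * cos (k * s)" if "s \<in> {-a<..<a}" "s < t" "t \<le> 0" for s t
    proof -
      have "cos (k * - s) < cos (k * - t)"
        using that k less_pi[OF that(1)] pi_gt_zero
        by (intro cos_monotone_0_pi) (auto simp: mult_nonneg_nonpos)
      then show ?thesis by simp
    qed
    show "- 1 * cos (k * s) < - 1 * cos (k * t)" if "t \<in> {-a<..<a}" "0 \<le> s" "s < t" for s t
    proof -
      have "cos (k * t) < cos (k * s)"
        using that k less_pi[OF that(1)] pi_gt_zero by (intro cos_monotone_0_pi) auto
      then show ?thesis by simp
    qed
    show "cos (k * s) > 0" if "s \<in> {-a..a}" for s using that by (intro bounds(2)) auto
    show "\<bar>- k * sin (k * a)\<bar> = cos (k * a)" "\<bar>- k * sin (k * - a)\<bar> = cos (k * - a)"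
      using bounds(1) by (intro bounds(4); simp)+
  qed auto
  with up show ?thesis by blast
qed

text \<open>Since \<open>\<bar>r\<bar> < 1 < k\<close>, only the form \<open>cosh (k s)\<close> occurs among the solutions of \<open>u'' = k\<^sup>2 u\<close>;
  its minimum is the single extremum.\<close>

lemma classification_below_minus_one:
  assumes k: "1 < k"
    and max: "maximal_cgc_solution (- k\<^sup>2) I y z \<theta>" and p: "p \<in> I"
    and cos: "\<And>s. s \<in> I \<Longrightarrow> cos (\<theta> s) \<noteq> 0"
  shows "\<exists>J \<beta>. up_to_integration_constants I (gen_curve y z) J \<beta> \<and> bounded_vertical_graph J \<beta>"
proof -
  define r where "r = sin (\<theta> p)"
  have r1: "\<bar>r\<bar> < 1" unfolding r_def using abs_sin_less_1[OF cos[OF p]] .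
  obtain b where b: "tanh b = 1 / k" using ex_tanh_eq[of "1 / k"] k by auto
  define a where "a = b / k"
  have a: "k * tanh (k * a) = 1" using b k by (simp add: a_def)
  have tanha: "tanh (k * a) = 1 / k" using b k by (simp add: a_def)
  have "tanh b > 0" using b k by simp
  then have apos: "a > 0" using k by (simp add: a_def)
  interpret profile "- k\<^sup>2" "\<lambda>s. cosh (k * s)" "\<lambda>s. k * sinh (k * s)" "{-a<..<a}"
    using k a by (rule profile_cosh_bounded)
  obtain Y where Y: "\<And>s. (Y has_real_derivative sqrt ((cosh (k * s))\<^sup>2 - (k * sinh (k * s))\<^sup>2)) (at s)"
    using antiderivative_exists by blast
  let ?\<beta> = "\<lambda>s. vector [0, Y s, ln (cosh (k * s))] :: real^3"
  have "0 < k" "\<bar>r\<bar> < k" using k r1 by linarith+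
  then obtain s1 where s1: "tanh (k * s1) = r / k" "k * sinh (k * s1) = r * cosh (k * s1)"
    using cosh_profile_match by blast
  have "r / k < 1 / k" "(- 1) / k < r / k"
    using r1 k by (intro divide_strict_right_mono; linarith)+
  then have "tanh (k * s1) < tanh (k * a)" "tanh (k * - a) < tanh (k * s1)"
    unfolding s1(1) tanha mult_minus_right tanh_minus by simp_all
  then have "k * s1 < k * a" "k * - a < k * s1" by (simp_all only: tanh_real_less_iff)
  then have s1J: "s1 \<in> {-a<..<a}" unfolding mult_less_cancel_left_pos[OF \<open>0 < k\<close>] by simp
  have up: "up_to_integration_constants I (gen_curve y z) {-a<..<a} ?\<beta>"
    by (rule profile_up_to_integration_constants[OF max p cos Y, of 1 s1])
      (use s1J s1(2) in \<open>simp_all add: r_def\<close>)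
  have "bounded_vertical_graph {-a<..<a} ?\<beta>"
    unfolding bounded_vertical_graph_def
  proof (rule bounded_profile_graph[OF refl apos _ Y, of 1])
    show "1 * cosh (k * t) < 1 * cosh (k * s)" if "s < t" "t \<le> 0" for s t
    proof -
      have "cosh (k * - t) < cosh (k * - s)"
        using that k by (intro cosh_real_strict_mono) (auto simp: mult_nonneg_nonpos)
      then show ?thesis by simp
    qed
    show "1 * cosh (k * s) < 1 * cosh (k * t)" if "0 \<le> s" "s < t" for s t
      using that k cosh_real_strict_mono[of "k * s" "k * t"] by simp
    show "\<bar>k * sinh (k * a)\<bar> = cosh (k * a)" "\<bar>k * sinh (k * - a)\<bar> = cosh (k * - a)"
      using k by (simp_all add: sinh_eq_tanh_cosh tanha abs_mult)
  qed auto
  with up show ?thesis by blast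
qed

text \<open>As \<open>y' = exp z cos \<theta>\<close> has no zero, \<open>y\<close> is injective by Rolle's theorem.\<close>

lemma generating_curve_graph:
  assumes sol: "cgc_solution c I y z \<theta>" and cos: "\<And>s. s \<in> I \<Longrightarrow> cos (\<theta> s) \<noteq> 0"
  shows "\<exists>f D. is_graph I (gen_curve y z) f D"
proof -
  have y: "(y has_real_derivative exp (z s) * cos (\<theta> s)) (at s)" if "s \<in> I" for s
    using sol that unfolding cgc_solution_def by blast
  have I: "is_interval I" using sol unfolding cgc_solution_def by blast
  have "y a \<noteq> y b" if ab: "a \<in> I" "b \<in> I" "a < b" for a b
  proof
    assume eq: "y a = y b"
    have sub: "x \<in> I" if "a \<le> x" "x \<le> b" for x
      using ab that mem_is_interval_1_I[OF I] by blast
    then have "continuous_on {a..b} y"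
      using y DERIV_isCont continuous_at_imp_continuous_on by (metis atLeastAtMost_iff)
    then obtain x where x: "a < x" "x < b" "(y has_real_derivative 0) (at x)"
    proof (rule Rolle[OF ab(3) eq, THEN exE])
      show "y differentiable (at x)" if "a < x" "x < b" for x
        using y[OF sub] that unfolding real_differentiable_def by (meson less_imp_le)
    qed auto
    have "x \<in> I" using sub x by simp
    then have "exp (z x) * cos (\<theta> x) = 0" using DERIV_unique[OF y x(3)] by blast
    then show False using cos[OF \<open>x \<in> I\<close>] by simp
  qed
  then have "inj_on y I" by (intro linorder_inj_onI') auto
  then have "is_graph I (gen_curve y z) (\<lambda>v. z (the_inv_into I y v)) (y ` I)"
    by (rule is_graph_inverse) (simp add: gen_curve_def)
  then show ?thesis by blast
qed

theorem theorem4p1: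
  fixes c :: real and I :: "real set" and y z \<theta> :: "real \<Rightarrow> real"
    and \<alpha> :: "real \<Rightarrow> real^3" and S :: "(real^3) set"
  assumes maximal: "maximal_cgc_solution c I y z \<theta>"
    and \<alpha>_eq: "\<alpha> = gen_curve y z"
    and S_eq: "S = invariant_surface I y z"
  shows "(c = 0 \<longrightarrow>
      S \<in> foliation3 \<or>
      (\<exists>J \<beta>. up_to_integration_constants I \<alpha> J \<beta> \<and> J = {1<..} \<and>
        (\<forall>s\<in>J. \<beta> s = vector [0, (s * sqrt (s\<^sup>2 - 1) - ln (s + sqrt (s\<^sup>2 - 1))) / 2, ln s])))
    \<and> (c = -1 \<longrightarrow>
      S \<in> foliation2 \<or>
      (\<exists>J \<beta>. up_to_integration_constants I \<alpha> J \<beta> \<and> is_graph J \<beta> (\<lambda>v. ln (cosh v)) UNIV))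
    \<and> (c \<in> {-1<..<0} \<longrightarrow>
      (\<exists>J \<beta>. up_to_integration_constants I \<alpha> J \<beta> \<and>
        ((\<exists>a. a \<noteq> 0 \<and> is_graph J \<beta> (\<lambda>v. ln (a * v)) {v. a * v > 0}) \<or>
         (\<exists>f. is_graph J \<beta> f UNIV \<and> single_minimum f UNIV) \<or>
         (\<exists>f a0. is_graph J \<beta> f {a0<..} \<and> (mono_on {a0<..} f \<or> antimono_on {a0<..} f)))))
    \<and> (c > 0 \<or> c < -1 \<longrightarrow>
      (\<exists>J \<beta>. up_to_integration_constants I \<alpha> J \<beta> \<and>
        (\<exists>f a0 b0. a0 < b0 \<and> is_graph J \<beta> f {a0<..<b0} \<and> bounded (f ` {a0<..<b0}) \<and>
           (single_maximum f {a0<..<b0} \<or> single_minimum f {a0<..<b0}) \<and>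
           vertical_towards J \<beta> a0 \<and> vertical_towards J \<beta> b0)))
    \<and> (S \<notin> foliation2 \<longrightarrow> (\<exists>f D. is_graph I \<alpha> f D))"
proof -
  have sol: "cgc_solution c I y z \<theta>" using maximal unfolding maximal_cgc_solution_def by blast
  then obtain p where p: "p \<in> I" unfolding cgc_solution_def by blast
  show ?thesis
  proof (cases "\<exists>s\<in>I. cos (\<theta> s) = 0")
    case True
    then obtain q where q: "q \<in> I" "cos (\<theta> q) = 0" by blast
    have "S \<in> foliation2" unfolding S_eq by (rule leaf_of_foliation2[OF maximal q])
    moreover have "c = - 1" by (rule cos_angle_zero_everywhere(1)[OF sol q])
    ultimately show ?thesis by auto
  next
    case False
    then have cos: "\<And>s. s \<in> I \<Longrightarrow> cos (\<theta> s) \<noteq> 0" by blast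
    show ?thesis unfolding \<alpha>_eq S_eq bounded_vertical_graph_def[symmetric]
    proof (intro conjI impI)
      assume "c = 0"
      show "invariant_surface I y z \<in> foliation3 \<or>
          (\<exists>J \<beta>. up_to_integration_constants I (gen_curve y z) J \<beta> \<and> J = {1<..} \<and>
          (\<forall>s\<in>J. \<beta> s = vector [0, (s * sqrt (s\<^sup>2 - 1) - ln (s + sqrt (s\<^sup>2 - 1))) / 2, ln s]))"
        using classification_flat[OF maximal[unfolded \<open>c = 0\<close>] p cos] by blast
    next
      assume "c = - 1"
      show "invariant_surface I y z \<in> foliation2 \<or>
          (\<exists>J \<beta>. up_to_integration_constants I (gen_curve y z) J \<beta> \<and> is_graph J \<beta> (\<lambda>v. ln (cosh v)) UNIV)"
        using classification_minus_one[OF maximal[unfolded \<open>c = - 1\<close>] p cos] by blast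
    next
      assume "c \<in> {-1<..<0}"
      then have k: "0 < sqrt (- c)" "sqrt (- c) < 1" "- (sqrt (- c))\<^sup>2 = c" by auto
      have m: "maximal_cgc_solution (- (sqrt (- c))\<^sup>2) I y z \<theta>" unfolding k(3) by (rule maximal)
      show "\<exists>J \<beta>. up_to_integration_constants I (gen_curve y z) J \<beta> \<and>
        ((\<exists>a. a \<noteq> 0 \<and> is_graph J \<beta> (\<lambda>v. ln (a * v)) {v. a * v > 0}) \<or>
         (\<exists>f. is_graph J \<beta> f UNIV \<and> single_minimum f UNIV) \<or>
         (\<exists>f a0. is_graph J \<beta> f {a0<..} \<and> (mono_on {a0<..} f \<or> antimono_on {a0<..} f)))"
        by (rule classification_between[OF k(1,2) m p cos])
    next
      assume "c > 0 \<or> c < - 1"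
      then show "\<exists>J \<beta>. up_to_integration_constants I (gen_curve y z) J \<beta> \<and> bounded_vertical_graph J \<beta>"
      proof
        assume "c > 0"
        then have k: "0 < sqrt c" "(sqrt c)\<^sup>2 = c" by auto
        have m: "maximal_cgc_solution ((sqrt c)\<^sup>2) I y z \<theta>" unfolding k(2) by (rule maximal)
        show ?thesis
          by (rule classification_positive[OF k(1) m p cos])
      next
        assume "c < - 1"
        then have k: "1 < sqrt (- c)" "- (sqrt (- c))\<^sup>2 = c" by auto
        have m: "maximal_cgc_solution (- (sqrt (- c))\<^sup>2) I y z \<theta>" unfolding k(2) by (rule maximal)
        show ?thesis
          by (rule classification_below_minus_one[OF k(1) m p cos])
      qed
    next
      show "\<exists>f D. is_graph I (gen_curve y z) f D" by (rule generating_curve_graph[OF sol cos])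
    qed
  qed
qed

end
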